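(* Let $\diamondsuit_t$ and $\Diamond$ be the $(C_4+t)$-operator and the $C_4$-operator on $\mathbb F_q^2$, respectively. Let $1\le p_1,p_2,p_3,p_4\le\infty$. (i) If $\Diamond(p_1,p_2,p_3,p_4)\lesssim1$, then $\diamondsuit_t(p_1,p_2,p_3,p_4)\lesssim1$. (ii) Moreover, there exist exponents $1\le a,b,c,e\le\infty$ such that $\diamondsuit_t(a,b,c,e)\lesssim1$ but $\Diamond(a,b,c,e)\lesssim1$ does not hold.
   Context: Conventions: $q$ ranges over powers of odd primes for which $3$ is a nonzero square in $\mathbb F_q$. For $x\in\mathbb F_q^2$ put $\|x\|=x_1^2+x_2^2$. For $t\in\mathbb F_q^*$, $S_t=\{x\in\mathbb F_q^2:\|x\|=t\}$, and $S_t(x)$ also denotes its indicator function. For $f:\mathbb F_q^2\to\mathbb R$: $\|f\|_p=(q^{-2}\sum_x|f(x)|^p)^{1/p}$ for $1\le p<\infty$ and $\|f\|_\infty=\max_x|f(x)|$. Exponents are extended real numbers. Operators on $\mathbb F_q^2$: $$\diamondsuit_t(f_1,f_2,f_3,f_4)=\frac{1}{q^2|S_t|}\sum_{x^1,\dots,x^4}S_t(x^1-x^2)S_t(x^2-x^3)S_t(x^3-x^4)S_t(x^4-x^1)S_t(x^1-x^3)\prod_{i=1}^4f_i(x^i),$$ $$\Diamond(f_1,f_2,f_3,f_4)=\frac{1}{q^2|S_t|^2}\sum_{x^1,\dots,x^4}S_t(x^1-x^2)S_t(x^2-x^3)S_t(x^3-x^4)S_t(x^4-x^1)\prod_{i=1}^4f_i(x^i),$$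 sums over $x^i\in\mathbb F_q^2$. For $\Phi$ either of these, $\Phi(p_1,\dots,p_4)$ is the smallest constant such that $\Phi(f_1,\dots,f_4)\le\Phi(p_1,\dots,p_4)\prod_i\|f_i\|_{p_i}$ for all non-negative real-valued $f_i$. $\Phi(p_1,\dots,p_4)\lesssim1$ means there is $C\ge1$, independent of $q$ and $t$, with $\Phi(p_1,\dots,p_4)\le C$ for all such $q$ and all $t\in\mathbb F_q^*$. *)

theory Defs
  imports
    "HOL-Algebra.Ring"
    "HOL-Computational_Algebra.Primes"
    "HOL-Library.Extended_Real"
    "HOL-Library.Indicator_Function"
begin

text \<open>
  The field with \<open>q\<close> elements is any record \<open>F\<close> with \<open>q = card (carrier F)\<close> that satisfies the
  following predicate.  The exponent \<open>k\<close> below is automatically positive, since a field has at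
  least two elements.
\<close>

definition admissible_field :: "'a ring \<Rightarrow> bool" where
  "admissible_field F \<longleftrightarrow>
     field F \<and> finite (carrier F) \<and>
     (\<exists>p k::nat. prime p \<and> odd p \<and> card (carrier F) = p ^ k) \<and>
     [(3::nat)] \<cdot>\<^bsub>F\<^esub> \<one>\<^bsub>F\<^esub> \<noteq> \<zero>\<^bsub>F\<^esub> \<and>
     (\<exists>a\<in>carrier F. a \<otimes>\<^bsub>F\<^esub> a = [(3::nat)] \<cdot>\<^bsub>F\<^esub> \<one>\<^bsub>F\<^esub>)"

definition plane :: "'a ring \<Rightarrow> ('a \<times> 'a) set" where
  "plane F = carrier F \<times> carrier F"

definition sqnorm :: "'a ring \<Rightarrow> 'a \<times> 'a \<Rightarrow> 'a" where
  "sqnorm F x = (fst x \<otimes>\<^bsub>F\<^esub> fst x) \<oplus>\<^bsub>F\<^esub> (snd x \<otimes>\<^bsub>F\<^esub> snd x)"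

definition vdiff :: "'a ring \<Rightarrow> 'a \<times> 'a \<Rightarrow> 'a \<times> 'a \<Rightarrow> 'a \<times> 'a" where
  "vdiff F x y = (fst x \<ominus>\<^bsub>F\<^esub> fst y, snd x \<ominus>\<^bsub>F\<^esub> snd y)"

definition circle :: "'a ring \<Rightarrow> 'a \<Rightarrow> ('a \<times> 'a) set" where
  "circle F t = {x \<in> plane F. sqnorm F x = t}"

definition Lnorm :: "'a ring \<Rightarrow> ereal \<Rightarrow> ('a \<times> 'a \<Rightarrow> real) \<Rightarrow> real" where
  "Lnorm F p f =
     (if p = \<infinity> then Max ((\<lambda>x. \<bar>f x\<bar>) ` plane F)
      else (1 / real (card (carrier F)) ^ 2 * (\<Sum>x\<in>plane F. \<bar>f x\<bar> powr real_of_ereal p))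
             powr (1 / real_of_ereal p))"

type_synonym 'a form4 =
  "'a ring \<Rightarrow> 'a \<Rightarrow> ('a \<times> 'a \<Rightarrow> real) \<Rightarrow> ('a \<times> 'a \<Rightarrow> real) \<Rightarrow>
   ('a \<times> 'a \<Rightarrow> real) \<Rightarrow> ('a \<times> 'a \<Rightarrow> real) \<Rightarrow> real"

definition C4_diag_op :: "'a form4" where
  "C4_diag_op F t f1 f2 f3 f4 =
     (let S = (\<lambda>x y. indicator (circle F t) (vdiff F x y) :: real) in
      1 / (real (card (carrier F)) ^ 2 * real (card (circle F t))) *
      (\<Sum>x1\<in>plane F. \<Sum>x2\<in>plane F. \<Sum>x3\<in>plane F. \<Sum>x4\<in>plane F.
         S x1 x2 * S x2 x3 * S x3 x4 * S x4 x1 * S x1 x3 * (f1 x1 * f2 x2 * f3 x3 * f4 x4)))"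

definition C4_op :: "'a form4" where
  "C4_op F t f1 f2 f3 f4 =
     (let S = (\<lambda>x y. indicator (circle F t) (vdiff F x y) :: real) in
      1 / (real (card (carrier F)) ^ 2 * real (card (circle F t)) ^ 2) *
      (\<Sum>x1\<in>plane F. \<Sum>x2\<in>plane F. \<Sum>x3\<in>plane F. \<Sum>x4\<in>plane F.
         S x1 x2 * S x2 x3 * S x3 x4 * S x4 x1 * (f1 x1 * f2 x2 * f3 x3 * f4 x4)))"

text \<open>
  For \<open>F\<close> admissible, \<open>t\<close> a nonzero element of \<open>F\<close> and exponents in \<open>{1..\<infinity>}\<close> the least constant
  below exists: the set of valid constants is closed, nonempty, and bounded below by the value of
  the form at four constant functions \<open>1\<close>.
\<close>

definition best_const ::
    "'a form4 \<Rightarrow> 'a ring \<Rightarrow> 'a \<Rightarrow> ereal \<Rightarrow> ereal \<Rightarrow> ereal \<Rightarrow> ereal \<Rightarrow> real" where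
  "best_const \<Phi> F t p1 p2 p3 p4 =
     (LEAST C. \<forall>f1 f2 f3 f4.
        (\<forall>x\<in>plane F. 0 \<le> f1 x \<and> 0 \<le> f2 x \<and> 0 \<le> f3 x \<and> 0 \<le> f4 x) \<longrightarrow>
        \<Phi> F t f1 f2 f3 f4 \<le> C * (Lnorm F p1 f1 * Lnorm F p2 f2 * Lnorm F p3 f3 * Lnorm F p4 f4))"

text \<open>
  The constant \<open>C\<close> has to be chosen before the field, and HOL cannot quantify over types inside a
  formula.  Hence the fields range over records with carrier a set of natural numbers; every finite
  field is isomorphic to one of these, and \<^const>\<open>best_const\<close> for \<^const>\<open>C4_op\<close> and \<^const>\<open>C4_diag_op\<close>
  is invariant under field isomorphisms.
\<close>

definition uniformly_bounded :: "nat form4 \<Rightarrow> ereal \<Rightarrow> ereal \<Rightarrow> ereal \<Rightarrow> ereal \<Rightarrow> bool" where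
  "uniformly_bounded \<Phi> p1 p2 p3 p4 \<longleftrightarrow>
     (\<exists>C\<ge>1. \<forall>F::nat ring. admissible_field F \<longrightarrow>
        (\<forall>t\<in>carrier F - {\<zero>\<^bsub>F\<^esub>}. best_const \<Phi> F t p1 p2 p3 p4 \<le> C))"

end

theory Submission
  imports Defs "HOL-Analysis.Convex" "HOL-Algebra.Multiplicative_Group" "HOL-Number_Theory.Cong"
begin

text \<open>
  Write \<open>u\<^sub>i = 1 / p\<^sub>i\<close>.  Testing the \<open>C\<^sub>4\<close>-operator with point masses at the origin in two opposite
  positions and the circle in the other two shows, as \<open>q \<rightarrow> \<infinity>\<close>, that its boundedness forces
  \<open>2(u\<^sub>1 + u\<^sub>3) + (u\<^sub>2 + u\<^sub>4) \<le> 2\<close> and \<open>(u\<^sub>1 + u\<^sub>3) + 2(u\<^sub>2 + u\<^sub>4) \<le> 2\<close>.  On this polytope a product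
  of powers is dominated by the corresponding products at its vertices, so the diamond form reduces
  to sums over single edges: two of the four points determine the others up to finitely many
  choices, because two circles meet in at most two points.  The only nontrivial vertex is the
  averaging estimate \<open>L\<^sup>3\<^sup>/\<^sup>2 \<times> L\<^sup>3\<^sup>/\<^sup>2\<close>, which needs no Fourier analysis: bound the cube of a sum over a
  circle by a sum over pairs of points and count the common neighbours of each pair.  The same estimate along the diagonal bounds the
  diamond form at \<open>(3/2, \<infinity>, 3/2, \<infinity>)\<close>, a point that violates the first inequality.
\<close>

section \<open>Graphs with small codegrees\<close>

text \<open>Cauchy-Schwarz is applied twice to the power sums: s2^2 <= s1 s3 and s1^2 <= |Y| s2.
  Eliminating s1 gives s2^4 <= |Y| s2 s3^2, and one factor s2 cancels.\<close>

lemma sum_squares_cubed_le: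
  fixes w :: "'v \<Rightarrow> real"
  assumes "finite Y" and w: "\<And>y. y \<in> Y \<Longrightarrow> 0 \<le> w y"
  shows "(\<Sum>y\<in>Y. w y ^ 2) ^ 3 \<le> real (card Y) * (\<Sum>y\<in>Y. w y ^ 3) ^ 2"
proof -
  define s1 s2 s3 where "s1 = (\<Sum>y\<in>Y. w y)" and "s2 = (\<Sum>y\<in>Y. w y ^ 2)" and "s3 = (\<Sum>y\<in>Y. w y ^ 3)"
  have nn: "0 \<le> s1" "0 \<le> s2" "0 \<le> s3"
    unfolding s1_def s2_def s3_def using w by (auto intro: sum_nonneg)
  have "s2 = (\<Sum>y\<in>Y. sqrt (w y) * sqrt (w y ^ 3))"
    unfolding s2_def
  proof (intro sum.cong refl)
    fix y assume "y \<in> Y"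
    then have "0 \<le> w y" by (rule w)
    then have "sqrt (w y ^ 2 * w y ^ 2) = w y ^ 2" by (simp only: real_sqrt_abs2 abs_power2)
    moreover have "w y ^ 2 * w y ^ 2 = w y * w y ^ 3" by (simp add: power2_eq_square power3_eq_cube)
    ultimately show "(w y)\<^sup>2 = sqrt (w y) * sqrt (w y ^ 3)" by (simp add: real_sqrt_mult)
  qed
  then have "s2 ^ 2 \<le> (\<Sum>y\<in>Y. (sqrt (w y)) ^ 2) * (\<Sum>y\<in>Y. (sqrt (w y ^ 3)) ^ 2)"
    by (simp add: Cauchy_Schwarz_ineq_sum)
  also have "\<dots> = s1 * s3" unfolding s1_def s3_def using w by simp
  finally have a: "s2 ^ 2 \<le> s1 * s3" .
  have b: "s1 ^ 2 \<le> real (card Y) * s2"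
    using Cauchy_Schwarz_ineq_sum[of "\<lambda>_. 1" w Y] by (simp add: s1_def s2_def)
  have "s2 * s2 ^ 3 = (s2 ^ 2) ^ 2" by (simp add: power2_eq_square power3_eq_cube)
  also have "\<dots> \<le> (s1 * s3) ^ 2" using a by (intro power_mono) auto
  also have "\<dots> = s1 ^ 2 * s3 ^ 2" by (simp add: power_mult_distrib)
  also have "\<dots> \<le> real (card Y) * s2 * s3 ^ 2" using b by (intro mult_right_mono) auto
  finally have "s2 * s2 ^ 3 \<le> s2 * (real (card Y) * s3 ^ 2)" by (simp add: mult_ac)
  then show ?thesis
    using nn by (cases "s2 = 0") (auto simp: s2_def s3_def mult_le_cancel_left)
qed

text \<open>Only the largest value is separated from the rest: the others are controlled by the
  off-diagonal products, which have few coincidences in a graph with small codegrees.\<close>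

lemma sum_squares_cubed_le_off_diagonal:
  fixes w :: "'v \<Rightarrow> real"
  assumes fin: "finite Y" and w: "\<And>y. y \<in> Y \<Longrightarrow> 0 \<le> w y" and s: "real (card Y) \<le> s"
  shows "(\<Sum>y\<in>Y. w y ^ 2) ^ 3 \<le> 4 * (\<Sum>y\<in>Y. w y ^ 3) ^ 2
           + 8 * s * (\<Sum>y\<in>Y. \<Sum>z\<in>Y - {y}. w y ^ 3 * w z ^ 3)"
proof (cases "Y = {}")
  case False
  obtain m where m: "m \<in> Y" "\<And>y. y \<in> Y \<Longrightarrow> w y \<le> w m"
  proof -
    have "Max (w ` Y) \<in> w ` Y" using fin False by simp
    then obtain m where "m \<in> Y" "w m = Max (w ` Y)" by auto
    then show thesis using that[of m] fin by simp
  qed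
  define Z where "Z = Y - {m}"
  have Z: "finite Z" "Y = insert m Z" "m \<notin> Z" using fin m by (auto simp: Z_def)
  have s0: "0 \<le> s" using s of_nat_0_le_iff order_trans by blast
  define r where "r = (\<Sum>y\<in>Z. w y ^ 2)"
  define r3 where "r3 = (\<Sum>y\<in>Z. w y ^ 3)"
  define off where "off = (\<Sum>y\<in>Y. \<Sum>z\<in>Y - {y}. w y ^ 3 * w z ^ 3)"
  have wm: "0 \<le> w m" and wZ: "\<And>y. y \<in> Z \<Longrightarrow> 0 \<le> w y \<and> w y \<le> w m"
    using w m by (auto simp: Z_def)
  have r: "0 \<le> r" "0 \<le> r3" unfolding r_def r3_def using wZ by (auto intro: sum_nonneg)
  have convex: "(x + y) ^ 3 \<le> 4 * (x ^ 3 + y ^ 3)" if "0 \<le> x" "0 \<le> y" for x y :: real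
  proof -
    have "4 * (x ^ 3 + y ^ 3) - (x + y) ^ 3 = 3 * (x + y) * (x - y) ^ 2"
      by (simp add: power2_eq_square power3_eq_cube algebra_simps)
    then show ?thesis using that by (metis add_nonneg_nonneg diff_ge_0_iff_ge mult_nonneg_nonneg zero_le_numeral zero_le_power2)
  qed
  have "r ^ 3 \<le> real (card Z) * r3 ^ 2"
    unfolding r_def r3_def using wZ Z by (intro sum_squares_cubed_le) auto
  also have "\<dots> \<le> s * r3 ^ 2"
    using s Z by (intro mult_right_mono) auto
  finally have rr: "r ^ 3 \<le> s * r3 ^ 2" .
  have off_eq: "off = (\<Sum>z\<in>Z. w m ^ 3 * w z ^ 3) + (\<Sum>y\<in>Z. \<Sum>z\<in>Y - {y}. w y ^ 3 * w z ^ 3)"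
    unfolding off_def using Z by simp
  \<comment> \<open>The diagonal terms w_y^6 of r3^2 are at most w_m^3 w_y^3 because w_m is maximal.
    So they fit into the row y = m of \<open>off\<close>, which the remaining terms leave
    free.\<close>
  have "r3 ^ 2 = (\<Sum>y\<in>Z. \<Sum>z\<in>Z. w y ^ 3 * w z ^ 3)"
    unfolding r3_def power2_eq_square by (simp add: sum_product)
  also have "\<dots> = (\<Sum>y\<in>Z. w y ^ 3 * w y ^ 3 + (\<Sum>z\<in>Z - {y}. w y ^ 3 * w z ^ 3))"
    using Z by (intro sum.cong refl sum.remove) auto
  also have "\<dots> = (\<Sum>y\<in>Z. w y ^ 3 * w y ^ 3) + (\<Sum>y\<in>Z. \<Sum>z\<in>Z - {y}. w y ^ 3 * w z ^ 3)"
    by (rule sum.distrib)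
  also have "\<dots> \<le> (\<Sum>z\<in>Z. w m ^ 3 * w z ^ 3) + (\<Sum>y\<in>Z. \<Sum>z\<in>Y - {y}. w y ^ 3 * w z ^ 3)"
    using Z wZ wm by (intro add_mono sum_mono mult_right_mono power_mono sum_mono2) auto
  finally have r3: "r3 ^ 2 \<le> off" using off_eq by simp
  have "0 \<le> off" using r3 by (meson order_trans zero_le_power2)
  have "w m ^ 3 \<le> (\<Sum>y\<in>Y. w y ^ 3)"
    using Z r by (simp add: r3_def)
  then have "(w m ^ 3) ^ 2 \<le> (\<Sum>y\<in>Y. w y ^ 3) ^ 2"
    using wm by (intro power_mono) auto
  then have wm6: "(w m ^ 2) ^ 3 \<le> (\<Sum>y\<in>Y. w y ^ 3) ^ 2"
    by (simp add: power_mult[symmetric] mult.commute)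
  have "(\<Sum>y\<in>Y. w y ^ 2) ^ 3 = (w m ^ 2 + r) ^ 3" using Z by (simp add: r_def)
  also have "\<dots> \<le> 4 * ((w m ^ 2) ^ 3 + r ^ 3)" using r by (intro convex) auto
  also have "\<dots> \<le> 4 * ((\<Sum>y\<in>Y. w y ^ 3) ^ 2 + s * off)"
    using add_mono[OF wm6 order_trans[OF rr mult_left_mono[OF r3 s0]]] by simp
  also have "\<dots> \<le> 4 * (\<Sum>y\<in>Y. w y ^ 3) ^ 2 + 8 * s * off"
    using s0 \<open>0 \<le> off\<close> by (simp add: algebra_simps)
  finally show ?thesis by (simp add: off_def)
qed auto

text \<open>The upper bounds for the diamond form are purely graph theoretic. Adjacency is a real
  0/1 function, so that products of edges can be summed directly; codegree at most 2 expresses that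
  circles of equal radius about distinct centres meet in at most two points.\<close>

locale sparse_graph =
  fixes V :: "'v set" and S :: "'v \<Rightarrow> 'v \<Rightarrow> real" and q s :: real
  assumes fin: "finite V"
    and S01: "S x y = 0 \<or> S x y = 1"
    and sym: "x \<in> V \<Longrightarrow> y \<in> V \<Longrightarrow> S x y = S y x"
    and irrefl: "x \<in> V \<Longrightarrow> S x x = 0"
    and degree: "x \<in> V \<Longrightarrow> (\<Sum>y\<in>V. S x y) = s"
    and codegree: "x \<in> V \<Longrightarrow> y \<in> V \<Longrightarrow> x \<noteq> y \<Longrightarrow> (\<Sum>z\<in>V. S x z * S z y) \<le> 2"
    and card_V: "real (card V) = q ^ 2" and q: "1 \<le> q"
begin

lemma S_nonneg: "0 \<le> S x y" and S_le_1: "S x y \<le> 1"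
  using S01[of x y] by auto

lemma V_nonempty: "V \<noteq> {}"
  using card_V q by (metis card.empty of_nat_0 power_not_zero zero_neq_one not_one_le_zero)

lemma s_nonneg: "0 \<le> s"
  using V_nonempty degree S_nonneg by (metis equals0I sum_nonneg)

lemma degree': "y \<in> V \<Longrightarrow> (\<Sum>x\<in>V. S x y) = s"
  using degree[of y] sym by (metis (mono_tags, lifting) sum.cong)

lemma codegree': "x \<in> V \<Longrightarrow> y \<in> V \<Longrightarrow> x \<noteq> y \<Longrightarrow> (\<Sum>z\<in>V. S x z * S y z) \<le> 2"
  "x \<in> V \<Longrightarrow> y \<in> V \<Longrightarrow> x \<noteq> y \<Longrightarrow> (\<Sum>z\<in>V. S z x * S z y) \<le> 2"
  using codegree[of x y] sym by (metis (mono_tags, lifting) sum.cong)+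

text \<open>The factor \<open>S x y\<close> disposes of the case x = y, in which the codegree would
  be the full degree, because no vertex is adjacent to itself.\<close>

lemma edge_codegree:
  assumes "x \<in> V" "y \<in> V"
  shows "S x y * (\<Sum>z\<in>V. S x z * S z y) \<le> S x y * 2"
    and "S x y * (\<Sum>z\<in>V. S y z * S z x) \<le> S x y * 2"
proof -
  have "(\<Sum>z\<in>V. S x z * S z y) \<le> 2 \<and> (\<Sum>z\<in>V. S y z * S z x) \<le> 2" if "x \<noteq> y"
    using that assms codegree by auto
  then show "S x y * (\<Sum>z\<in>V. S x z * S z y) \<le> S x y * 2"
    and "S x y * (\<Sum>z\<in>V. S y z * S z x) \<le> S x y * 2"
    using irrefl assms by (cases "x = y"; auto intro!: mult_left_mono S_nonneg)+
qed

text \<open>Sort the s^2 paths of length two from x by their endpoint: at most s return to x and at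
  most two reach any other vertex. Hence s (s - 1) <= 2 q^2, which is impossible for s > 2
  q.\<close>

lemma degree_le: "s \<le> 2 * q"
proof (rule ccontr)
  assume "\<not> s \<le> 2 * q"
  then have s: "2 * q < s" by simp
  obtain x where x: "x \<in> V" using V_nonempty by auto
  have "s * s = (\<Sum>z\<in>V. S x z * s)"
    using degree[OF x] by (simp add: sum_distrib_right[symmetric])
  also have "\<dots> = (\<Sum>z\<in>V. \<Sum>y\<in>V. S x z * S z y)"
    by (intro sum.cong refl) (simp add: degree sum_distrib_left[symmetric])
  also have "\<dots> = (\<Sum>y\<in>V. \<Sum>z\<in>V. S x z * S z y)" by (rule sum.swap)
  also have "\<dots> = (\<Sum>z\<in>V. S x z * S z x) + (\<Sum>y\<in>V - {x}. \<Sum>z\<in>V. S x z * S z y)"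
    using x fin by (rule sum.remove[rotated])
  also have "\<dots> \<le> (\<Sum>z\<in>V. S x z) + (\<Sum>y\<in>V - {x}. 2)"
    using x by (intro add_mono sum_mono codegree mult_left_le S_nonneg S_le_1) auto
  also have "\<dots> \<le> s + (\<Sum>y\<in>V. 2)"
    using fin by (intro add_mono sum_mono2) (auto simp: degree x)
  also have "\<dots> = s + 2 * q ^ 2" by (simp add: card_V)
  finally have "s * (s - 1) \<le> 2 * q ^ 2" by (simp add: algebra_simps)
  moreover have "(2 * q) * (2 * q - 1) \<le> s * (s - 1)"
    using s q by (intro mult_mono) auto
  moreover have "(2 * q) * (2 * q - 1) \<ge> 2 * q * q"
    using q by (intro mult_left_mono) auto
  moreover have "s * (s - 1) > (2 * q) * (2 * q - 1)"
    using s q by (intro mult_strict_mono) auto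
  ultimately show False by (simp add: power2_eq_square)
qed

text \<open>With g = w^2 this is the L^(3/2) to L^3 estimate for averages over circles, in
  unnormalised form. Summing the pointwise bound over x works because the factor s stands only
  before the off-diagonal part, where each pair has at most two common neighbours; both parts are
  then of order s B^2.\<close>

lemma sum_cubed_neighbour_sums_le:
  assumes w: "\<And>y. y \<in> V \<Longrightarrow> 0 \<le> w y"
  shows "(\<Sum>x\<in>V. (\<Sum>y\<in>V. S x y * w y ^ 2) ^ 3) \<le> 48 * q * (\<Sum>y\<in>V. w y ^ 3) ^ 2"
proof -
  define B where "B = (\<Sum>y\<in>V. w y ^ 3)"
  have B: "0 \<le> B" unfolding B_def using w by (auto intro: sum_nonneg)
  have B2: "B ^ 2 = (\<Sum>y\<in>V. \<Sum>z\<in>V. w y ^ 3 * w z ^ 3)"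
    unfolding B_def power2_eq_square by (simp add: sum_product)
  define off where "off x = (\<Sum>y\<in>V. \<Sum>z\<in>V - {y}. S x y * S x z * (w y ^ 3 * w z ^ 3))" for x
  have S_restrict: "(\<Sum>y\<in>V. S x y * f y) = (\<Sum>y | y \<in> V \<and> S x y = 1. f y)" for x and f :: "'v \<Rightarrow> real"
    using S01[of x] fin by (intro sum.mono_neutral_cong_right) auto
  have pointwise: "(\<Sum>y\<in>V. S x y * w y ^ 2) ^ 3 \<le> 4 * (\<Sum>y\<in>V. S x y * w y ^ 3) ^ 2 + 8 * s * off x"
    if x: "x \<in> V" for x
  proof -
    define Y where "Y = {y. y \<in> V \<and> S x y = 1}"
    have "real (card Y) = s"
      using S_restrict[of x "\<lambda>_. 1"] degree[OF x] by (simp add: Y_def)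
    then have "(\<Sum>y\<in>Y. w y ^ 2) ^ 3 \<le> 4 * (\<Sum>y\<in>Y. w y ^ 3) ^ 2
           + 8 * s * (\<Sum>y\<in>Y. \<Sum>z\<in>Y - {y}. w y ^ 3 * w z ^ 3)"
      using w fin by (intro sum_squares_cubed_le_off_diagonal) (auto simp: Y_def)
    moreover have "(\<Sum>y\<in>Y. \<Sum>z\<in>Y - {y}. w y ^ 3 * w z ^ 3) = off x"
    proof -
      have "off x = (\<Sum>y\<in>V. S x y * (\<Sum>z\<in>V - {y}. S x z * (w y ^ 3 * w z ^ 3)))"
        unfolding off_def by (simp add: sum_distrib_left mult.assoc)
      also have "\<dots> = (\<Sum>y\<in>Y. \<Sum>z\<in>V - {y}. S x z * (w y ^ 3 * w z ^ 3))"
        unfolding S_restrict Y_def ..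
      also have "\<dots> = (\<Sum>y\<in>Y. \<Sum>z\<in>Y - {y}. w y ^ 3 * w z ^ 3)"
        using S01[of x] fin
        by (intro sum.cong refl sum.mono_neutral_cong_right) (auto simp: Y_def)
      finally show ?thesis by simp
    qed
    ultimately show ?thesis unfolding S_restrict Y_def by simp
  qed
  \<comment> \<open>Summation over x first turns edge products into codegrees. The set
    \<open>U y\<close> is V - {y} for \<open>off\<close> and V for \<open>diag\<close>.\<close>
  have rearrange: "(\<Sum>x\<in>V. \<Sum>y\<in>V. \<Sum>z\<in>U y. S x y * S x z * (w y ^ 3 * w z ^ 3))
      = (\<Sum>y\<in>V. \<Sum>z\<in>U y. (\<Sum>x\<in>V. S x y * S x z) * (w y ^ 3 * w z ^ 3))" for U
  proof -
    have "(\<Sum>x\<in>V. \<Sum>y\<in>V. \<Sum>z\<in>U y. S x y * S x z * (w y ^ 3 * w z ^ 3))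
      = (\<Sum>y\<in>V. \<Sum>x\<in>V. \<Sum>z\<in>U y. S x y * S x z * (w y ^ 3 * w z ^ 3))" by (rule sum.swap)
    also have "\<dots> = (\<Sum>y\<in>V. \<Sum>z\<in>U y. \<Sum>x\<in>V. S x y * S x z * (w y ^ 3 * w z ^ 3))"
      by (rule sum.cong[OF refl], rule sum.swap)
    finally show ?thesis by (simp add: sum_distrib_right)
  qed
  have off: "(\<Sum>x\<in>V. off x) \<le> 2 * B ^ 2"
  proof -
    have "(\<Sum>x\<in>V. off x) = (\<Sum>y\<in>V. \<Sum>z\<in>V - {y}. (\<Sum>x\<in>V. S x y * S x z) * (w y ^ 3 * w z ^ 3))"
      unfolding off_def by (rule rearrange)
    also have "\<dots> \<le> (\<Sum>y\<in>V. \<Sum>z\<in>V - {y}. 2 * (w y ^ 3 * w z ^ 3))"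
      using w by (intro sum_mono mult_right_mono codegree') auto
    also have "\<dots> \<le> (\<Sum>y\<in>V. \<Sum>z\<in>V. 2 * (w y ^ 3 * w z ^ 3))"
      using w fin by (intro sum_mono sum_mono2) auto
    also have "\<dots> = 2 * B ^ 2" unfolding B2 by (simp add: sum_distrib_left)
    finally show ?thesis .
  qed
  have diag: "(\<Sum>x\<in>V. (\<Sum>y\<in>V. S x y * w y ^ 3) ^ 2) \<le> (s + 2) * B ^ 2"
  proof -
    have "(\<Sum>x\<in>V. (\<Sum>y\<in>V. S x y * w y ^ 3) ^ 2)
        = (\<Sum>x\<in>V. \<Sum>y\<in>V. \<Sum>z\<in>V. S x y * S x z * (w y ^ 3 * w z ^ 3))"
      unfolding power2_eq_square by (simp add: sum_product mult_ac)
    also have "\<dots> = (\<Sum>y\<in>V. \<Sum>z\<in>V. (\<Sum>x\<in>V. S x y * S x z) * (w y ^ 3 * w z ^ 3))"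
      by (rule rearrange)
    also have "\<dots> \<le> (\<Sum>y\<in>V. \<Sum>z\<in>V. (s + 2) * (w y ^ 3 * w z ^ 3))"
    proof (intro sum_mono mult_right_mono)
      fix y z assume yz: "y \<in> V" "z \<in> V"
      show "(\<Sum>x\<in>V. S x y * S x z) \<le> s + 2"
      proof (cases "y = z")
        case True
        have "(\<Sum>x\<in>V. S x y * S x z) \<le> (\<Sum>x\<in>V. S x y)"
          by (intro sum_mono mult_left_le S_nonneg S_le_1)
        then show ?thesis using degree'[OF yz(1)] by simp
      next
        case False
        then show ?thesis using codegree'(2)[OF yz] s_nonneg by simp
      qed
    qed (use w in auto)
    also have "\<dots> = (s + 2) * B ^ 2" unfolding B2 by (simp add: sum_distrib_left)
    finally show ?thesis .
  qed
  have "(\<Sum>x\<in>V. (\<Sum>y\<in>V. S x y * w y ^ 2) ^ 3)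
      \<le> (\<Sum>x\<in>V. 4 * (\<Sum>y\<in>V. S x y * w y ^ 3) ^ 2 + 8 * s * off x)"
    by (intro sum_mono pointwise)
  also have "\<dots> = 4 * (\<Sum>x\<in>V. (\<Sum>y\<in>V. S x y * w y ^ 3) ^ 2) + 8 * s * (\<Sum>x\<in>V. off x)"
    by (simp add: sum.distrib sum_distrib_left)
  also have "\<dots> \<le> 4 * ((s + 2) * B ^ 2) + 8 * s * (2 * B ^ 2)"
    using diag off s_nonneg by (intro add_mono mult_left_mono) auto
  also have "\<dots> = (20 * s + 8) * B ^ 2" by (simp add: algebra_simps)
  \<comment> \<open>From s <= 2 q and 1 <= q: 20 s + 8 <= 40 q + 8 q.\<close>
  also have "\<dots> \<le> (48 * q) * B ^ 2" using degree_le q by (intro mult_right_mono) auto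
  finally show ?thesis by (simp add: B_def)
qed

text \<open>The hypotheses say that v^2 and w^2 have normalised L^(3/2) norm at most 1. Instead of
  Hoelder, a crude Young inequality is applied after dividing the neighbour sum c by q, a scaling
  that makes both resulting terms of order q^3.\<close>

lemma bilinear_bound:
  assumes v: "\<And>y. y \<in> V \<Longrightarrow> 0 \<le> v y" "(\<Sum>y\<in>V. v y ^ 3) \<le> q ^ 2"
    and w: "\<And>y. y \<in> V \<Longrightarrow> 0 \<le> w y" "(\<Sum>y\<in>V. w y ^ 3) \<le> q ^ 2"
  shows "(\<Sum>x\<in>V. \<Sum>y\<in>V. S x y * (v x ^ 2 * w y ^ 2)) \<le> 49 * q ^ 3"
proof -
  define c where "c x = (\<Sum>y\<in>V. S x y * w y ^ 2)" for x
  have c: "0 \<le> c x" for x unfolding c_def by (intro sum_nonneg mult_nonneg_nonneg S_nonneg) auto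
  have young: "a ^ 2 * b \<le> a ^ 3 + b ^ 3" if "0 \<le> a" "0 \<le> b" for a b :: real
  proof (cases "a \<le> b")
    case True
    then have "a ^ 2 * b \<le> b ^ 2 * b" using that by (intro mult_right_mono power_mono) auto
    then show ?thesis using that by (simp add: power2_eq_square power3_eq_cube add_increasing)
  next
    case False
    then have "a ^ 2 * b \<le> a ^ 2 * a" using that by (intro mult_left_mono) auto
    then show ?thesis using that by (simp add: power2_eq_square power3_eq_cube add_increasing2)
  qed
  have "(\<Sum>x\<in>V. \<Sum>y\<in>V. S x y * (v x ^ 2 * w y ^ 2)) = (\<Sum>x\<in>V. q * (v x ^ 2 * (c x / q)))"
    unfolding c_def sum_divide_distrib sum_distrib_left using q by (intro sum.cong refl) simp
  also have "\<dots> \<le> (\<Sum>x\<in>V. q * (v x ^ 3 + (c x / q) ^ 3))"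
    using q c v by (intro sum_mono mult_left_mono young) auto
  also have "\<dots> = q * (\<Sum>x\<in>V. v x ^ 3) + (\<Sum>x\<in>V. c x ^ 3) / q ^ 2"
    using q by (simp add: sum.distrib sum_distrib_left sum_divide_distrib power_divide
        distrib_left power2_eq_square power3_eq_cube)
  also have "\<dots> \<le> q * q ^ 2 + (48 * q * (q ^ 2) ^ 2) / q ^ 2"
  proof (intro add_mono mult_left_mono divide_right_mono)
    have "(\<Sum>x\<in>V. c x ^ 3) \<le> 48 * q * (\<Sum>y\<in>V. w y ^ 3) ^ 2"
      unfolding c_def by (intro sum_cubed_neighbour_sums_le w)
    also have "\<dots> \<le> 48 * q * (q ^ 2) ^ 2"
      using w q by (intro mult_left_mono power_mono sum_nonneg) auto
    finally show "(\<Sum>x\<in>V. c x ^ 3) \<le> 48 * q * (q ^ 2) ^ 2" .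
  qed (use v q in auto)
  also have "\<dots> = 49 * q ^ 3"
    using q by (simp add: power2_eq_square power3_eq_cube)
  finally show ?thesis .
qed

text \<open>The monomials 1, v^3 and w^3 cost at most s q^2 <= 2 q^3 each, since only degrees enter;
  the mixed monomial costs 49 q^3.\<close>

lemma edge_bound:
  assumes v: "\<And>y. y \<in> V \<Longrightarrow> 0 \<le> v y" "(\<Sum>y\<in>V. v y ^ 3) \<le> q ^ 2"
    and w: "\<And>y. y \<in> V \<Longrightarrow> 0 \<le> w y" "(\<Sum>y\<in>V. w y ^ 3) \<le> q ^ 2"
  shows "(\<Sum>x\<in>V. \<Sum>y\<in>V. S x y * (1 + v x ^ 3 + w y ^ 3 + v x ^ 2 * w y ^ 2)) \<le> 55 * q ^ 3"
proof -
  have "(\<Sum>x\<in>V. \<Sum>y\<in>V. S x y) = s * q ^ 2"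
    using card_V by (simp add: degree)
  moreover have "(\<Sum>x\<in>V. \<Sum>y\<in>V. S x y * v x ^ 3) = s * (\<Sum>x\<in>V. v x ^ 3)"
    by (simp add: sum_distrib_right[symmetric] degree sum_distrib_left)
  moreover have "(\<Sum>x\<in>V. \<Sum>y\<in>V. S x y * w y ^ 3) = s * (\<Sum>y\<in>V. w y ^ 3)"
    by (subst sum.swap) (simp add: sum_distrib_right[symmetric] degree' sum_distrib_left)
  moreover have "s * (\<Sum>x\<in>V. v x ^ 3) \<le> s * q ^ 2" "s * (\<Sum>y\<in>V. w y ^ 3) \<le> s * q ^ 2"
    using v w s_nonneg by (auto intro: mult_left_mono)
  moreover have "s * q ^ 2 \<le> 2 * q ^ 3"
    using mult_right_mono[OF degree_le, of "q ^ 2"] by (simp add: power2_eq_square power3_eq_cube)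
  ultimately show ?thesis
    using bilinear_bound[OF v w] by (simp add: distrib_left sum.distrib)
qed

section \<open>Weighted sums over diamonds, and their reduction to a single edge\<close>

definition diamond_sum :: "('v \<Rightarrow> 'v \<Rightarrow> 'v \<Rightarrow> 'v \<Rightarrow> real) \<Rightarrow> real" where
  "diamond_sum h = (\<Sum>x1\<in>V. \<Sum>x2\<in>V. \<Sum>x3\<in>V. \<Sum>x4\<in>V.
     S x1 x2 * S x2 x3 * S x3 x4 * S x4 x1 * S x1 x3 * h x1 x2 x3 x4)"

lemma diamond_sum_mono:
  assumes "\<And>x1 x2 x3 x4. x1 \<in> V \<Longrightarrow> x2 \<in> V \<Longrightarrow> x3 \<in> V \<Longrightarrow> x4 \<in> V \<Longrightarrow> h x1 x2 x3 x4 \<le> h' x1 x2 x3 x4"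
  shows "diamond_sum h \<le> diamond_sum h'"
  unfolding diamond_sum_def by (intro sum_mono mult_left_mono assms mult_nonneg_nonneg S_nonneg)

lemma diamond_sum_add: "diamond_sum (\<lambda>a b c d. h a b c d + h' a b c d) = diamond_sum h + diamond_sum h'"
  unfolding diamond_sum_def by (simp add: distrib_left sum.distrib)

lemma diamond_sum_cmult: "diamond_sum (\<lambda>a b c d. k * h a b c d) = k * diamond_sum h"
  unfolding diamond_sum_def by (simp add: sum_distrib_left mult_ac)

text \<open>Exchanges the ends x1, x3 of the chord. Together with \<open>diamond_sum_swap\<close>,
  which exchanges x2 and x4, it carries every side of the diamond to the side x1 x2.\<close>

lemma diamond_sum_reflect: "diamond_sum (\<lambda>a b c d. h c b a d) = diamond_sum h"
proof -
  have "diamond_sum (\<lambda>a b c d. h c b a d) = (\<Sum>x1\<in>V. \<Sum>x3\<in>V. \<Sum>x2\<in>V. \<Sum>x4\<in>V.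
     S x1 x2 * S x2 x3 * S x3 x4 * S x4 x1 * S x1 x3 * h x3 x2 x1 x4)"
    unfolding diamond_sum_def by (rule sum.cong[OF refl], rule sum.swap)
  also have "\<dots> = (\<Sum>x3\<in>V. \<Sum>x1\<in>V. \<Sum>x2\<in>V. \<Sum>x4\<in>V.
     S x1 x2 * S x2 x3 * S x3 x4 * S x4 x1 * S x1 x3 * h x3 x2 x1 x4)" by (rule sum.swap)
  also have "\<dots> = (\<Sum>x3\<in>V. \<Sum>x1\<in>V. \<Sum>x2\<in>V. \<Sum>x4\<in>V.
     S x3 x2 * S x2 x1 * S x1 x4 * S x4 x3 * S x3 x1 * h x3 x2 x1 x4)"
    by (intro sum.cong refl) (simp add: sym mult_ac)
  also have "\<dots> = diamond_sum h"
    unfolding diamond_sum_def by (rule sum.cong[OF refl], rule sum.swap)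
  finally show ?thesis .
qed

lemma diamond_sum_swap: "diamond_sum (\<lambda>a b c d. h a d c b) = diamond_sum h"
proof -
  have "diamond_sum (\<lambda>a b c d. h a d c b) = (\<Sum>x1\<in>V. \<Sum>x3\<in>V. \<Sum>x2\<in>V. \<Sum>x4\<in>V.
     S x1 x2 * S x2 x3 * S x3 x4 * S x4 x1 * S x1 x3 * h x1 x4 x3 x2)"
    unfolding diamond_sum_def by (rule sum.cong[OF refl], rule sum.swap)
  also have "\<dots> = (\<Sum>x1\<in>V. \<Sum>x3\<in>V. \<Sum>x4\<in>V. \<Sum>x2\<in>V.
     S x1 x2 * S x2 x3 * S x3 x4 * S x4 x1 * S x1 x3 * h x1 x4 x3 x2)"
    by (rule sum.cong[OF refl], rule sum.cong[OF refl], rule sum.swap)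
  also have "\<dots> = (\<Sum>x1\<in>V. \<Sum>x3\<in>V. \<Sum>x4\<in>V. \<Sum>x2\<in>V.
     S x1 x4 * S x4 x3 * S x3 x2 * S x2 x1 * S x1 x3 * h x1 x4 x3 x2)"
    by (intro sum.cong refl) (simp add: sym mult_ac)
  also have "\<dots> = diamond_sum h"
    unfolding diamond_sum_def by (rule sum.cong[OF refl], rule sum.swap)
  finally show ?thesis .
qed

text \<open>Once the chord x1 x3 is fixed, x2 and x4 range independently over the common neighbours
  of its ends, at most two choices each.\<close>

lemma diamond_sum_diagonal_le:
  assumes h: "\<And>x y. x \<in> V \<Longrightarrow> y \<in> V \<Longrightarrow> 0 \<le> h x y"
  shows "diamond_sum (\<lambda>a b c d. h a c) \<le> 4 * (\<Sum>x\<in>V. \<Sum>y\<in>V. S x y * h x y)"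
proof -
  have "diamond_sum (\<lambda>a b c d. h a c) = (\<Sum>x1\<in>V. \<Sum>x3\<in>V. \<Sum>x2\<in>V. \<Sum>x4\<in>V.
     S x1 x2 * S x2 x3 * S x3 x4 * S x4 x1 * S x1 x3 * h x1 x3)"
    unfolding diamond_sum_def by (rule sum.cong[OF refl], rule sum.swap)
  also have "\<dots> = (\<Sum>x1\<in>V. \<Sum>x3\<in>V. S x1 x3 * h x1 x3 * ((\<Sum>x2\<in>V. S x1 x2 * S x2 x3) * (\<Sum>x4\<in>V. S x3 x4 * S x4 x1)))"
    unfolding sum_product unfolding sum_distrib_left by (intro sum.cong refl) (simp only: mult_ac)
  also have "\<dots> \<le> (\<Sum>x1\<in>V. \<Sum>x3\<in>V. S x1 x3 * h x1 x3 * (2 * 2))"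
  proof (intro sum_mono)
    fix x y assume xy: "x \<in> V" "y \<in> V"
    have "(S x y * h x y) * ((\<Sum>z\<in>V. S x z * S z y) * (\<Sum>z\<in>V. S y z * S z x)) 
      \<le> (S x y * h x y) * (2 * 2)" if "x \<noteq> y"
      using xy h that
      by (intro mult_left_mono mult_mono codegree mult_nonneg_nonneg sum_nonneg S_nonneg) auto
    then show "S x y * h x y * ((\<Sum>z\<in>V. S x z * S z y) * (\<Sum>z\<in>V. S y z * S z x)) \<le> S x y * h x y * (2 * 2)"
      using xy irrefl by (cases "x = y") auto
  qed
  also have "\<dots> = 4 * (\<Sum>x\<in>V. \<Sum>y\<in>V. S x y * h x y)" by (simp add: sum_distrib_left mult_ac)
  finally show ?thesis .
qed

text \<open>For a fixed side x1 x2 the vertices are eliminated in the order x4, x3. First x4 is a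
  common neighbour of x3 and x1; the chord \<open>S x1 x3\<close> survives this bound and then makes
  x3 a common neighbour of x1 and x2.\<close>

lemma diamond_sum_side_le:
  assumes h: "\<And>x y. x \<in> V \<Longrightarrow> y \<in> V \<Longrightarrow> 0 \<le> h x y"
  shows "diamond_sum (\<lambda>a b c d. h a b) \<le> 4 * (\<Sum>x\<in>V. \<Sum>y\<in>V. S x y * h x y)"
proof -
  have "diamond_sum (\<lambda>a b c d. h a b) = (\<Sum>x1\<in>V. \<Sum>x2\<in>V. \<Sum>x3\<in>V.
     S x1 x2 * S x2 x3 * h x1 x2 * (S x1 x3 * (\<Sum>x4\<in>V. S x3 x4 * S x4 x1)))"
    unfolding diamond_sum_def by (simp add: sum_distrib_left mult_ac)
  also have "\<dots> \<le> (\<Sum>x1\<in>V. \<Sum>x2\<in>V. \<Sum>x3\<in>V. S x1 x2 * S x2 x3 * h x1 x2 * (S x1 x3 * 2))"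
    by (intro sum_mono mult_left_mono[OF edge_codegree(2)] mult_nonneg_nonneg S_nonneg h)
  also have "\<dots> = (\<Sum>x1\<in>V. \<Sum>x2\<in>V. 2 * h x1 x2 * (S x1 x2 * (\<Sum>x3\<in>V. S x1 x3 * S x3 x2)))"
    by (intro sum.cong refl) (simp add: sum_distrib_left mult_ac sym)
  also have "\<dots> \<le> (\<Sum>x1\<in>V. \<Sum>x2\<in>V. 2 * h x1 x2 * (S x1 x2 * 2))"
    by (intro sum_mono mult_left_mono[OF edge_codegree(1)] mult_nonneg_nonneg h) auto
  also have "\<dots> = 4 * (\<Sum>x\<in>V. \<Sum>y\<in>V. S x y * h x y)" by (simp add: sum_distrib_left mult_ac)
  finally show ?thesis .
qed

end

section \<open>Circles over finite fields of odd order\<close>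

lemma (in field) roots_of_square:
  assumes a: "a \<in> carrier R"
  shows "finite {m \<in> carrier R. m \<otimes> m = a}" and "card {m \<in> carrier R. m \<otimes> m = a} \<le> 2"
proof -
  have "\<exists>r. {m \<in> carrier R. m \<otimes> m = a} \<subseteq> {r, \<ominus> r}"
  proof (cases "\<exists>r\<in>carrier R. r \<otimes> r = a")
    case True
    then obtain r where r: "r \<in> carrier R" "r \<otimes> r = a" by blast
    have "m = r \<or> m = \<ominus> r" if m: "m \<in> carrier R" "m \<otimes> m = a" for m
    proof -
      have "(m \<ominus> r) \<otimes> (m \<oplus> r) = m \<otimes> m \<ominus> r \<otimes> r" using m(1) r(1) by algebra
      also have "\<dots> = \<zero>" using m r a by (simp)
      finally have "m \<ominus> r = \<zero> \<or> m \<oplus> r = \<zero>" using m r by (simp add: integral_iff)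
      then show ?thesis using m r by (auto simp: r_right_minus_eq minus_equality)
    qed
    then show ?thesis by blast
  qed blast
  then obtain r where "{m \<in> carrier R. m \<otimes> m = a} \<subseteq> {r, \<ominus> r}" by blast
  moreover have "card {r, \<ominus> r} \<le> 2" by (simp add: card_insert_le_m1)
  ultimately show "finite {m \<in> carrier R. m \<otimes> m = a}" "card {m \<in> carrier R. m \<otimes> m = a} \<le> 2"
    by (meson finite.emptyI finite_insert finite_subset card_mono order_trans)+
qed

text \<open>In complex notation z = a + bi, w = c + di, the dot and cross products are the parts of
  conj(z) w. The identities read z |w|^2 = (z conj(w)) w and w |z|^2 = (conj(z) w) z: either vector
  is recovered from the other and the two products, up to a norm.\<close>

lemma (in cring) lagrange_rotation:
  assumes "a \<in> carrier R" "b \<in> carrier R" "c \<in> carrier R" "d \<in> carrier R"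
  shows "a \<otimes> (c \<otimes> c \<oplus> d \<otimes> d) = (a \<otimes> c \<oplus> b \<otimes> d) \<otimes> c \<oplus> (a \<otimes> d \<ominus> b \<otimes> c) \<otimes> d"
    and "b \<otimes> (c \<otimes> c \<oplus> d \<otimes> d) = (a \<otimes> c \<oplus> b \<otimes> d) \<otimes> d \<ominus> (a \<otimes> d \<ominus> b \<otimes> c) \<otimes> c"
    and "c \<otimes> (a \<otimes> a \<oplus> b \<otimes> b) = (a \<otimes> c \<oplus> b \<otimes> d) \<otimes> a \<ominus> (a \<otimes> d \<ominus> b \<otimes> c) \<otimes> b"
    and "d \<otimes> (a \<otimes> a \<oplus> b \<otimes> b) = (a \<otimes> c \<oplus> b \<otimes> d) \<otimes> b \<oplus> (a \<otimes> d \<ominus> b \<otimes> c) \<otimes> a"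
  using assms by (algebra, algebra, algebra, algebra)

lemma (in ring) minus_right_cancel:
  assumes "a \<ominus> c = b \<ominus> c" "a \<in> carrier R" "b \<in> carrier R" "c \<in> carrier R"
  shows "a = b"
proof -
  have "a = (a \<ominus> c) \<oplus> c" "b = (b \<ominus> c) \<oplus> c" using assms(2-4) by (algebra, algebra)
  then show ?thesis using assms(1) by simp
qed

lemma (in ring) minus_left_cancel:
  assumes "c \<ominus> a = c \<ominus> b" "a \<in> carrier R" "b \<in> carrier R" "c \<in> carrier R"
  shows "a = b"
proof -
  have "a = c \<ominus> (c \<ominus> a)" "b = c \<ominus> (c \<ominus> b)" using assms(2-4) by (algebra, algebra)
  then show ?thesis using assms(1) by simp
qed

text \<open>Moving (a, b) by -k (1, m) changes the norm by k times a factor linear in k. The root of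
  that factor gives the second intersection of the circle with the line of slope m.\<close>

lemma (in cring) reflection_identity:
  assumes "a \<in> carrier R" "b \<in> carrier R" "k \<in> carrier R" "m \<in> carrier R"
  shows "(a \<ominus> k) \<otimes> (a \<ominus> k) \<oplus> (b \<ominus> k \<otimes> m) \<otimes> (b \<ominus> k \<otimes> m)
    = (a \<otimes> a \<oplus> b \<otimes> b) \<oplus> k \<otimes> (k \<otimes> (\<one> \<oplus> m \<otimes> m) \<ominus> (\<one> \<oplus> \<one>) \<otimes> (a \<oplus> b \<otimes> m))"
  using assms by algebra

locale odd_finite_field = field R for R :: "'a ring" (structure) +
  assumes finite_carrier: "finite (carrier R)"
    and odd_card: "odd (card (carrier R))"
begin

text \<open>By Lagrange in the additive group, q times \<one> is \<zero>. If 2 vanished, the odd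
  multiple q of \<one> would equal \<one>.\<close>

lemma two_neq_zero: "\<one> \<oplus> \<one> \<noteq> \<zero>"
proof
  assume two: "\<one> \<oplus> \<one> = \<zero>"
  obtain j where j: "card (carrier R) = 2 * j + 1" using odd_card by (auto elim: oddE)
  have even: "[(2 * i :: nat)] \<cdot> \<one> = \<zero>" for i
    by (induction i) (auto simp: two add.nat_pow_Suc a_assoc)
  have "[card (carrier R)] \<cdot> \<one> = \<zero>"
    using group.pow_order_eq_1[OF add.is_group, of \<one>] finite_carrier
    by (simp add: add_pow_def order_def)
  moreover have "[card (carrier R)] \<cdot> \<one> = \<one>" unfolding j by (simp add: even)
  ultimately show False by simp
qed

lemma double_eq_iff: "a \<in> carrier R \<Longrightarrow> b \<in> carrier R \<Longrightarrow> a \<oplus> a = b \<oplus> b \<longleftrightarrow> a = b"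
proof
  assume ab: "a \<in> carrier R" "b \<in> carrier R" "a \<oplus> a = b \<oplus> b"
  have "(\<one> \<oplus> \<one>) \<otimes> (a \<ominus> b) = (a \<oplus> a) \<ominus> (b \<oplus> b)" using ab(1,2) by algebra
  also have "\<dots> = \<zero>" using ab by (simp)
  finally have "a \<ominus> b = \<zero>" using two_neq_zero ab by (simp add: integral_iff)
  then show "a = b" using ab by (simp)
qed auto

abbreviation q where "q \<equiv> card (carrier R)"

lemma q_pos: "0 < q"
  using finite_carrier by (simp add: card_gt_0_iff) blast

lemma finite_plane [simp]: "finite (plane R)" and card_plane: "card (plane R) = q ^ 2"
  using finite_carrier by (simp_all add: plane_def card_cartesian_product power2_eq_square)

end

locale circle_field = odd_finite_field +
  fixes t assumes t: "t \<in> carrier R" "t \<noteq> \<zero>"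
begin

definition S :: "'a \<times> 'a \<Rightarrow> 'a \<times> 'a \<Rightarrow> real" where
  "S x y = indicator (circle R t) (vdiff R x y)"

abbreviation "s \<equiv> real (card (circle R t))"

lemma S_eq: "S (a, b) (c, d) = (if (a \<ominus> c) \<otimes> (a \<ominus> c) \<oplus> (b \<ominus> d) \<otimes> (b \<ominus> d) = t then 1 else 0)"
  if "a \<in> carrier R" "b \<in> carrier R" "c \<in> carrier R" "d \<in> carrier R"
  using that by (simp add: S_def indicator_def circle_def vdiff_def sqnorm_def plane_def)

lemma S_sym: "x \<in> plane R \<Longrightarrow> y \<in> plane R \<Longrightarrow> S x y = S y x"
proof -
  assume "x \<in> plane R" "y \<in> plane R"
  then obtain a b c d where x: "x = (a, b)" "y = (c, d)"
    and car: "a \<in> carrier R" "b \<in> carrier R" "c \<in> carrier R" "d \<in> carrier R"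
    by (auto simp: plane_def)
  have "(a \<ominus> c) \<otimes> (a \<ominus> c) \<oplus> (b \<ominus> d) \<otimes> (b \<ominus> d) = (c \<ominus> a) \<otimes> (c \<ominus> a) \<oplus> (d \<ominus> b) \<otimes> (d \<ominus> b)"
    using car by algebra
  then show ?thesis using car by (simp add: x S_eq)
qed

lemma S_irrefl: "x \<in> plane R \<Longrightarrow> S x x = 0"
proof -
  assume "x \<in> plane R"
  then obtain a b where x: "x = (a, b)" and car: "a \<in> carrier R" "b \<in> carrier R"
    by (auto simp: plane_def)
  have "(a \<ominus> a) \<otimes> (a \<ominus> a) \<oplus> (b \<ominus> b) \<otimes> (b \<ominus> b) = \<zero>" using car by algebra
  then show ?thesis using t car by (simp add: x S_eq)
qed

lemma finite_circle [simp]: "finite (circle R t)"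
  by (rule finite_subset[OF _ finite_plane]) (auto simp: circle_def)

lemma S_degree: "x \<in> plane R \<Longrightarrow> (\<Sum>y\<in>plane R. S x y) = s"
proof -
  assume "x \<in> plane R"
  have vdiff_vdiff: "vdiff R x (vdiff R x y) = y" if "y \<in> plane R" for y
  proof -
    have "a \<ominus> (a \<ominus> c) = c" if "a \<in> carrier R" "c \<in> carrier R" for a c
      using that by algebra
    then show ?thesis using that \<open>x \<in> plane R\<close> by (auto simp: vdiff_def plane_def)
  qed
  have closed: "vdiff R x y \<in> plane R" if "y \<in> plane R" for y
    using that \<open>x \<in> plane R\<close> by (auto simp: vdiff_def plane_def)
  have "(\<Sum>y\<in>plane R. S x y) = (\<Sum>y\<in>plane R. indicator (circle R t) y)"
    by (rule sum.reindex_bij_witness[of _ "vdiff R x" "vdiff R x"])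
       (auto simp: vdiff_vdiff closed S_def)
  also have "\<dots> = (\<Sum>y\<in>circle R t. 1)"
    by (intro sum.mono_neutral_cong_right) (auto simp: circle_def)
  also have "\<dots> = s" by simp
  finally show ?thesis .
qed

text \<open>The two circle equations fix the inner product of \<open>w\<close> and \<open>d = (d1, d2)\<close>, and by Lagrange's
  identity also the square of their cross product; these two numbers determine \<open>w\<close> unless \<open>d\<close> is
  isotropic, in which case there is no solution.\<close>

lemma circle_inter:
  assumes d: "d1 \<in> carrier R" "d2 \<in> carrier R" "(d1, d2) \<noteq> (\<zero>, \<zero>)"
  shows "card {w \<in> circle R t. vdiff R w (d1, d2) \<in> circle R t} \<le> 2"
proof -
  define W where "W = {w \<in> circle R t. vdiff R w (d1, d2) \<in> circle R t}"
  define D where "D = d1 \<otimes> d1 \<oplus> d2 \<otimes> d2"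
  define dot where "dot w = fst w \<otimes> d1 \<oplus> snd w \<otimes> d2" for w :: "'a \<times> 'a"
  define cross where "cross w = fst w \<otimes> d2 \<ominus> snd w \<otimes> d1" for w :: "'a \<times> 'a"
  have D: "D \<in> carrier R" using d by (simp add: D_def)
  have W: "fst w \<in> carrier R" "snd w \<in> carrier R" "dot w \<in> carrier R" "cross w \<in> carrier R"
    "fst w \<otimes> fst w \<oplus> snd w \<otimes> snd w = t" "dot w \<oplus> dot w = D"
    "dot w \<otimes> dot w \<oplus> cross w \<otimes> cross w = t \<otimes> D" if w: "w \<in> W" for w
  proof -
    obtain a b where ab: "w = (a, b)" by force
    have car: "a \<in> carrier R" "b \<in> carrier R" and 1: "a \<otimes> a \<oplus> b \<otimes> b = t"
      and 2: "(a \<ominus> d1) \<otimes> (a \<ominus> d1) \<oplus> (b \<ominus> d2) \<otimes> (b \<ominus> d2) = t"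
      using w by (auto simp: W_def circle_def plane_def vdiff_def sqnorm_def ab)
    show "fst w \<in> carrier R" "snd w \<in> carrier R" "dot w \<in> carrier R" "cross w \<in> carrier R"
      "fst w \<otimes> fst w \<oplus> snd w \<otimes> snd w = t"
      using car d 1 by (auto simp: ab dot_def cross_def)
    \<comment> \<open>Subtracting the two circle equations cancels the norm of w and leaves 2 (w .
      d) = D.\<close>
    have "dot w \<oplus> dot w = (a \<otimes> a \<oplus> b \<otimes> b) \<ominus> ((a \<ominus> d1) \<otimes> (a \<ominus> d1) \<oplus> (b \<ominus> d2) \<otimes> (b \<ominus> d2)) \<oplus> D"
      unfolding ab dot_def D_def fst_conv snd_conv using car d(1,2) by algebra
    then show "dot w \<oplus> dot w = D" using 1 2 t D by (simp)
    have "dot w \<otimes> dot w \<oplus> cross w \<otimes> cross w = (a \<otimes> a \<oplus> b \<otimes> b) \<otimes> D"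
      unfolding ab dot_def cross_def D_def fst_conv snd_conv using car d(1,2) by algebra
    then show "dot w \<otimes> dot w \<oplus> cross w \<otimes> cross w = t \<otimes> D" using 1 by simp
  qed
  have fst_D: "fst w \<otimes> D = dot w \<otimes> d1 \<oplus> cross w \<otimes> d2" if w: "w \<in> W" for w
    using lagrange_rotation(1)[OF W(1,2)[OF w] d(1,2)] by (simp add: dot_def cross_def D_def)
  have snd_D: "snd w \<otimes> D = dot w \<otimes> d2 \<ominus> cross w \<otimes> d1" if w: "w \<in> W" for w
    using lagrange_rotation(2)[OF W(1,2)[OF w] d(1,2)] by (simp add: dot_def cross_def D_def)
  have d1_t: "d1 \<otimes> t = dot w \<otimes> fst w \<ominus> cross w \<otimes> snd w" if w: "w \<in> W" for w
    using lagrange_rotation(3)[OF W(1,2)[OF w] d(1,2)] W(5)[OF w] by (simp add: dot_def cross_def)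
  have d2_t: "d2 \<otimes> t = dot w \<otimes> snd w \<oplus> cross w \<otimes> fst w" if w: "w \<in> W" for w
    using lagrange_rotation(4)[OF W(1,2)[OF w] d(1,2)] W(5)[OF w] by (simp add: dot_def cross_def)
  have "D \<noteq> \<zero>" if w: "w \<in> W" for w
  proof
    assume D0: "D = \<zero>"
    have "dot w = \<zero>" using double_eq_iff[of "dot w" \<zero>] W[OF w] D0 by simp
    moreover have "cross w = \<zero>" using W[OF w] \<open>dot w = \<zero>\<close> D0 t by (simp add: integral_iff)
    ultimately have "d1 \<otimes> t = \<zero> \<otimes> fst w \<ominus> \<zero> \<otimes> snd w" "d2 \<otimes> t = \<zero> \<otimes> snd w \<oplus> \<zero> \<otimes> fst w"
      using d1_t[OF w] d2_t[OF w] by simp_all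
    then have "d1 \<otimes> t = \<zero>" "d2 \<otimes> t = \<zero>" using W(1,2)[OF w] by simp_all
    then show False using t d by (simp add: integral_iff)
  qed
  have inj: "inj_on cross W"
  proof (rule inj_onI)
    fix w w' assume w: "w \<in> W" "w' \<in> W" "cross w = cross w'"
    then have "dot w = dot w'" using double_eq_iff[of "dot w" "dot w'"] W(3,6) by auto
    then have "fst w \<otimes> D = fst w' \<otimes> D" "snd w \<otimes> D = snd w' \<otimes> D"
      using w fst_D snd_D by auto
    then show "w = w'"
      using m_rcancel[of D] \<open>\<And>w. w \<in> W \<Longrightarrow> D \<noteq> \<zero>\<close> w D W(1,2) by (auto intro: prod_eqI)
  qed
  show ?thesis
  proof (cases "W = {}")
    case False
    then obtain w0 where w0: "w0 \<in> W" by blast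
    \<comment> \<open>All points of \<open>W\<close> share one dot product, hence one squared cross
      product. As \<open>cross\<close> is injective on \<open>W\<close>, the at most two square
      roots bound the number of points.\<close>
    have "cross w \<otimes> cross w = cross w0 \<otimes> cross w0" if w: "w \<in> W" for w
    proof -
      have "dot w = dot w0" using double_eq_iff[of "dot w" "dot w0"] W(3,6) w w0 by auto
      moreover have "cross u \<otimes> cross u = (dot u \<otimes> dot u \<oplus> cross u \<otimes> cross u) \<ominus> dot u \<otimes> dot u"
        if "u \<in> W" for u using W(3,4)[OF that] by algebra
      ultimately show ?thesis using W(7) w w0 by metis
    qed
    then have "cross ` W \<subseteq> {m \<in> carrier R. m \<otimes> m = cross w0 \<otimes> cross w0}"
      using W(4) by auto
    then have "card (cross ` W) \<le> 2"
      using roots_of_square[of "cross w0 \<otimes> cross w0"] W(4)[OF w0]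
      by (meson card_mono m_closed order_trans)
    then show ?thesis using card_image[OF inj] by (simp add: W_def)
  qed (simp add: W_def[symmetric])
qed

text \<open>Translation by -y sends a common neighbour z to w = z - y on the circle, and w - (x - y)
  = z - x is on the circle too. This is the situation of \<open>circle_inter\<close> with d = x -
  y.\<close>

lemma S_codegree:
  assumes "x \<in> plane R" "y \<in> plane R" "x \<noteq> y"
  shows "(\<Sum>z\<in>plane R. S x z * S z y) \<le> 2"
proof -
  define d where "d = vdiff R x y"
  have closed: "vdiff R u v \<in> plane R" if "u \<in> plane R" "v \<in> plane R" for u v
    using that by (auto simp: vdiff_def plane_def)
  have d: "d \<in> plane R" "d \<noteq> (\<zero>, \<zero>)"
    using assms by (auto simp: d_def vdiff_def plane_def r_right_minus_eq)
  define Z where "Z = {z \<in> plane R. vdiff R x z \<in> circle R t \<and> vdiff R z y \<in> circle R t}"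
  have "(\<Sum>z\<in>plane R. S x z * S z y) = (\<Sum>z\<in>plane R. if z \<in> Z then 1 else 0)"
    by (intro sum.cong refl) (auto simp: S_def Z_def indicator_def)
  also have "\<dots> = real (card Z)"
    by (simp add: sum.If_cases Z_def Int_def conj_commute)
  also have "card Z \<le> card {w \<in> circle R t. vdiff R w (fst d, snd d) \<in> circle R t}"
  proof (rule card_inj_on_le[of "\<lambda>z. vdiff R z y"])
    show "inj_on (\<lambda>z. vdiff R z y) Z"
    proof (rule inj_onI)
      fix z z' assume "z \<in> Z" "z' \<in> Z" and eq: "vdiff R z y = vdiff R z' y"
      then have "z \<in> plane R" "z' \<in> plane R" by (simp_all add: Z_def)
      then show "z = z'"
        using eq assms minus_right_cancel[of "fst z" "fst y" "fst z'"]
          minus_right_cancel[of "snd z" "snd y" "snd z'"]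
        by (auto simp: vdiff_def plane_def)
    qed
    have "vdiff R (vdiff R z y) d = vdiff R z x" if "z \<in> plane R" for z
    proof -
      have "(a \<ominus> c) \<ominus> (b \<ominus> c) = a \<ominus> b" if "a \<in> carrier R" "b \<in> carrier R" "c \<in> carrier R" for a b c
        using that by algebra
      then show ?thesis using that assms by (auto simp: d_def vdiff_def plane_def)
    qed
    moreover have "vdiff R z x \<in> circle R t" if "z \<in> Z" for z
      using S_sym[of x z] that assms by (auto simp: Z_def S_def indicator_def split: if_splits)
    ultimately show "(\<lambda>z. vdiff R z y) ` Z \<subseteq> {w \<in> circle R t. vdiff R w (fst d, snd d) \<in> circle R t}"
      by (auto simp: Z_def)
  qed simp
  also have "card {w \<in> circle R t. vdiff R w (fst d, snd d) \<in> circle R t} \<le> 2"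
    using d by (intro circle_inter) (auto simp: plane_def)
  finally show ?thesis by simp
qed

text \<open>Reflecting a point of the circle in the direction \<open>(1, m)\<close> produces a further point for every
  slope \<open>m\<close> that is neither isotropic nor orthogonal to the given point.\<close>

lemma card_circle_ge:
  assumes "circle R t \<noteq> {}"
  shows "q \<le> card (circle R t) + 3"
proof -
  obtain a b where car: "a \<in> carrier R" "b \<in> carrier R" and ab: "a \<otimes> a \<oplus> b \<otimes> b = t"
    using assms by (auto simp: circle_def plane_def sqnorm_def)
  \<comment> \<open>\<open>I\<close> contains the at most two isotropic slopes, \<open>J\<close> the
    at most one slope orthogonal to (a, b), for which the reflection does not move the point. These
    account for the 3 in the statement.\<close>
  define I where "I = {m \<in> carrier R. m \<otimes> m = \<ominus> \<one>}"
  define J where "J = {m \<in> carrier R. a \<oplus> b \<otimes> m = \<zero>}"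
  define M where "M = carrier R - I - J"
  have I: "card I \<le> 2" unfolding I_def by (intro roots_of_square) simp
  have "m = m'" if "m \<in> J" "m' \<in> J" for m m'
  proof -
    have mc: "m \<in> carrier R" "m' \<in> carrier R" and m: "a \<oplus> b \<otimes> m = \<zero>" "a \<oplus> b \<otimes> m' = \<zero>"
      using that by (auto simp: J_def)
    have "b \<otimes> (m \<ominus> m') = (a \<oplus> b \<otimes> m) \<ominus> (a \<oplus> b \<otimes> m')" using car mc by algebra
    also have "\<dots> = \<zero>" by (simp add: m r_right_minus_eq)
    finally have "b = \<zero> \<or> m \<ominus> m' = \<zero>" using car mc by (simp add: integral_iff)
    \<comment> \<open>With b = \<zero> the equation defining \<open>J\<close> would give a =
      \<zero>, and then t = \<zero>.\<close>
    moreover have "b \<noteq> \<zero>" using m(1) mc ab car t by auto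
    ultimately show ?thesis using mc by (simp)
  qed
  then have J: "card J \<le> 1" using card_le_Suc0_iff_eq[of J] finite_carrier by (simp add: J_def)
  have "q - card I - card J \<le> card M"
    unfolding M_def using finite_carrier
    by (metis (no_types, lifting) I_def J_def diff_card_le_card_Diff diff_le_mono finite_Collect_conjI finite_subset le_trans mem_Collect_eq subsetI)
  then have card_M: "q \<le> card M + 3" using I J by linarith
  define N where "N m = \<one> \<oplus> m \<otimes> m" for m
  \<comment> \<open>\<open>k m\<close> is the root 2 (a + b m) / (1 + m^2) of the linear factor in
    \<open>reflection_identity\<close>.\<close>
  define k where "k m = (\<one> \<oplus> \<one>) \<otimes> (a \<oplus> b \<otimes> m) \<otimes> inv (N m)" for m
  have M: "m \<in> carrier R" "N m \<in> carrier R" "N m \<noteq> \<zero>" "k m \<in> carrier R" "k m \<noteq> \<zero>"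
    "k m \<otimes> N m = (\<one> \<oplus> \<one>) \<otimes> (a \<oplus> b \<otimes> m)" if "m \<in> M" for m
  proof -
    show m: "m \<in> carrier R" using that by (simp add: M_def)
    then show Nc: "N m \<in> carrier R" by (simp add: N_def)
    show N0: "N m \<noteq> \<zero>"
      using that m minus_equality[of "m \<otimes> m" \<one>] by (auto simp: N_def M_def I_def a_comm)
    then have "N m \<in> Units R" using Nc by (simp add: field_Units)
    then have inv: "inv (N m) \<in> carrier R" "inv (N m) \<otimes> N m = \<one>" by auto
    then show "k m \<in> carrier R" using m car by (simp add: k_def)
    show *: "k m \<otimes> N m = (\<one> \<oplus> \<one>) \<otimes> (a \<oplus> b \<otimes> m)"
      unfolding k_def using inv Nc m car by (simp add: m_assoc)
    have "a \<oplus> b \<otimes> m \<noteq> \<zero>" using that m by (auto simp: M_def J_def)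
    then have "(\<one> \<oplus> \<one>) \<otimes> (a \<oplus> b \<otimes> m) \<noteq> \<zero>" using two_neq_zero car m by (simp add: integral_iff)
    then show "k m \<noteq> \<zero>" using * Nc by auto
  qed
  define g where "g m = (a \<ominus> k m, b \<ominus> k m \<otimes> m)" for m
  \<comment> \<open>The displacement k (1, m) determines k, and then m because k is nonzero.\<close>
  have "inj_on g M"
  proof (rule inj_onI)
    fix m m' assume m: "m \<in> M" "m' \<in> M" "g m = g m'"
    have "k m = k m'" "k m \<otimes> m = k m' \<otimes> m'"
      using m M(1,4)[OF m(1)] M(1,4)[OF m(2)] car by (auto simp: g_def intro: minus_left_cancel[of a] minus_left_cancel[of b])
    then show "m = m'" using m_lcancel[of "k m" m m'] M[OF m(1)] M[OF m(2)] by auto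
  qed
  moreover have "g ` M \<subseteq> circle R t"
  proof
    fix p assume "p \<in> g ` M"
    then obtain m where m: "m \<in> M" "p = g m" by blast
    note Mm = M[OF m(1)]
    have "(a \<ominus> k m) \<otimes> (a \<ominus> k m) \<oplus> (b \<ominus> k m \<otimes> m) \<otimes> (b \<ominus> k m \<otimes> m)
      = (a \<otimes> a \<oplus> b \<otimes> b) \<oplus> k m \<otimes> (k m \<otimes> N m \<ominus> (\<one> \<oplus> \<one>) \<otimes> (a \<oplus> b \<otimes> m))"
      unfolding N_def using car Mm(4,1) by (rule reflection_identity)
    also have "\<dots> = t" using Mm car ab t by (simp add: integral_iff)
    finally show "p \<in> circle R t"
      using m Mm car by (simp add: circle_def plane_def sqnorm_def g_def)
  qed
  ultimately have "card M \<le> card (circle R t)" by (intro card_inj_on_le) auto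
  then show ?thesis using card_M by simp
qed

end

section \<open>Interpolation between the vertices of the polytope\<close>

definition edge_weight :: "real \<Rightarrow> real \<Rightarrow> real" where
  "edge_weight v w = 1 + v ^ 3 + w ^ 3 + v ^ 2 * w ^ 2"

lemma edge_weight_nonneg: "0 \<le> v \<Longrightarrow> 0 \<le> w \<Longrightarrow> 0 \<le> edge_weight v w"
  by (simp add: edge_weight_def)

text \<open>Both bases are replaced by their maximum with 1; the 1 takes up the slack when \<alpha>
  + \<beta> < 1.\<close>

lemma powr_mult_powr_le_max:
  fixes x y :: real
  assumes "0 \<le> x" "0 \<le> y" "0 \<le> \<alpha>" "0 \<le> \<beta>" "\<alpha> + \<beta> \<le> 1"
  shows "x powr \<alpha> * y powr \<beta> \<le> max 1 (max x y)"
proof -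
  define m where "m = max 1 (max x y)"
  have "x powr \<alpha> * y powr \<beta> \<le> m powr \<alpha> * m powr \<beta>"
    using assms by (intro mult_mono powr_mono2) (auto simp: m_def)
  also have "\<dots> = m powr (\<alpha> + \<beta>)" by (simp add: powr_add)
  also have "\<dots> \<le> m powr 1" using assms by (intro powr_mono) (auto simp: m_def)
  also have "\<dots> = m" by (simp add: m_def)
  finally show ?thesis by (simp add: m_def)
qed

text \<open>The exponents \<open>(3A, 3B)\<close> lie in the convex hull of \<open>(0, 0)\<close>, \<open>(3, 0)\<close>, \<open>(0, 3)\<close> and \<open>(2, 2)\<close>,
  which are the exponents of the four monomials of \<^const>\<open>edge_weight\<close>.\<close>

lemma powr_mult_powr_le_edge_weight:
  fixes v w :: real
  assumes v: "0 \<le> v" and w: "0 \<le> w" and AB: "0 \<le> A" "0 \<le> B" "2 * A + B \<le> 2" "A + 2 * B \<le> 2"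
  shows "v powr (3 * A) * w powr (3 * B) \<le> edge_weight v w"
proof -
  \<comment> \<open>By symmetry B <= A may be assumed. The product then splits as (v^3)^(A - B)
    times ((v w)^2)^(3 B / 2), whose weights add up to A + B / 2 <= 1.\<close>
  have *: "v powr (3 * A) * w powr (3 * B) \<le> edge_weight v w"
    if "0 < v" "0 < w" "0 \<le> B" "B \<le> A" "2 * A + B \<le> 2" for v w A B :: real
  proof -
    have "v powr (3 * A) = v powr (3 * (A - B)) * v powr (2 * (3 / 2 * B))"
      by (simp add: algebra_simps flip: powr_add)
    moreover have "w powr (3 * B) = w powr (2 * (3 / 2 * B))" by simp
    ultimately have "v powr (3 * A) * w powr (3 * B)
        = v powr (3 * (A - B)) * ((v * w) powr (2 * (3 / 2 * B)))"
      by (simp add: powr_mult)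
    also have "\<dots> = (v powr 3) powr (A - B) * ((v * w) powr 2) powr (3 / 2 * B)"
      by (simp only: powr_powr)
    also have "\<dots> = (v ^ 3) powr (A - B) * ((v * w) ^ 2) powr (3 / 2 * B)"
      using that by simp
    also have "\<dots> \<le> max 1 (max (v ^ 3) ((v * w) ^ 2))"
      using that by (intro powr_mult_powr_le_max) auto
    also have "\<dots> \<le> edge_weight v w"
      using that by (auto simp: edge_weight_def power_mult_distrib)
    finally show ?thesis .
  qed
  show ?thesis
  proof (cases "v = 0 \<or> w = 0")
    \<comment> \<open>In HOL \<open>0 powr x\<close> is 0 even for x = 0, so the left side
      vanishes.\<close>
    case True
    then show ?thesis using edge_weight_nonneg[OF v w] by auto
  next
    case False
    then have pos: "0 < v" "0 < w" using v w by auto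
    show ?thesis
    proof (cases "B \<le> A")
      case True
      then show ?thesis using pos AB by (intro *) auto
    next
      case False
      then have "w powr (3 * B) * v powr (3 * A) \<le> edge_weight w v" using pos AB by (intro *) auto
      then show ?thesis by (simp add: edge_weight_def mult_ac add_ac)
    qed
  qed
qed

text \<open>Replacing v1, v3 by their maximum and v2, v4 by theirs leaves two variables. The two
  maxima are attained at one of four index pairs, and each of these pairs is a side of the
  diamond.\<close>

lemma powr_prod_le_edge_weights:
  fixes v1 v2 v3 v4 u1 u2 u3 u4 :: real
  assumes v: "0 \<le> v1" "0 \<le> v2" "0 \<le> v3" "0 \<le> v4" and u: "0 \<le> u1" "0 \<le> u2" "0 \<le> u3" "0 \<le> u4"
    and "2 * (u1 + u3) + (u2 + u4) \<le> 2" "(u1 + u3) + 2 * (u2 + u4) \<le> 2"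
  shows "v1 powr (3 * u1) * v2 powr (3 * u2) * v3 powr (3 * u3) * v4 powr (3 * u4)
    \<le> edge_weight v1 v2 + edge_weight v3 v2 + edge_weight v3 v4 + edge_weight v1 v4"
proof -
  define m n where "m = max v1 v3" and "n = max v2 v4"
  have "v1 powr (3 * u1) * v2 powr (3 * u2) * v3 powr (3 * u3) * v4 powr (3 * u4)
      \<le> m powr (3 * u1) * n powr (3 * u2) * m powr (3 * u3) * n powr (3 * u4)"
    using v u by (intro mult_mono powr_mono2) (auto simp: m_def n_def)
  also have "\<dots> = m powr (3 * (u1 + u3)) * n powr (3 * (u2 + u4))"
    by (simp add: distrib_left powr_add mult_ac)
  also have "\<dots> \<le> edge_weight m n"
    using assms by (intro powr_mult_powr_le_edge_weight) (auto simp: m_def n_def)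
  also have "\<dots> \<le> edge_weight v1 v2 + edge_weight v3 v2 + edge_weight v3 v4 + edge_weight v1 v4"
    using edge_weight_nonneg v by (auto simp: m_def n_def max_def add_nonneg_nonneg add_increasing add_increasing2)
  finally show ?thesis .
qed

section \<open>The diamond sum for exponents in the polytope\<close>

context sparse_graph
begin

text \<open>Each of the four sides contributes at most 4 * 55 q^3: the factor 4 comes from
  completing an edge to a diamond, the 55 from \<open>edge_bound\<close>.\<close>

lemma diamond_sum_powr_le:
  assumes v: "\<And>i x. x \<in> V \<Longrightarrow> 0 \<le> v i x" "\<And>i. (\<Sum>x\<in>V. v i x ^ 3) \<le> q ^ 2"
    and u: "0 \<le> u1" "0 \<le> u2" "0 \<le> u3" "0 \<le> u4"
      "2 * (u1 + u3) + (u2 + u4) \<le> 2" "(u1 + u3) + 2 * (u2 + u4) \<le> 2"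
  shows "diamond_sum (\<lambda>a b c d. v (1::nat) a powr (3 * u1) * v 2 b powr (3 * u2) * v 3 c powr (3 * u3)
      * v 4 d powr (3 * u4)) \<le> 880 * q ^ 3" (is "diamond_sum ?h \<le> _")
proof -
  define E where "E i j x y = edge_weight (v i x) (v j y)" for i j x y
  have side: "diamond_sum (\<lambda>a b c d. E i j a b) \<le> 220 * q ^ 3" for i j
  proof -
    have "diamond_sum (\<lambda>a b c d. E i j a b) \<le> 4 * (\<Sum>x\<in>V. \<Sum>y\<in>V. S x y * E i j x y)"
      using v by (intro diamond_sum_side_le) (auto simp: E_def edge_weight_nonneg)
    also have "\<dots> \<le> 4 * (55 * q ^ 3)"
      unfolding E_def edge_weight_def using v by (intro mult_left_mono edge_bound) auto
    finally show ?thesis by simp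
  qed
  have "diamond_sum ?h \<le> diamond_sum (\<lambda>a b c d. E 1 2 a b + E 3 2 c b + E 3 4 c d + E 1 4 a d)"
    unfolding E_def using v u by (intro diamond_sum_mono powr_prod_le_edge_weights) auto
  also have "\<dots> = diamond_sum (\<lambda>a b c d. E 1 2 a b) + diamond_sum (\<lambda>a b c d. E 3 2 c b)
      + diamond_sum (\<lambda>a b c d. E 3 4 c d) + diamond_sum (\<lambda>a b c d. E 1 4 a d)"
    by (simp add: diamond_sum_add)
  also have "diamond_sum (\<lambda>a b c d. E 3 2 c b) = diamond_sum (\<lambda>a b c d. E 3 2 a b)"
    by (rule diamond_sum_reflect[of "\<lambda>a b c d. E 3 2 a b"])
  also have "diamond_sum (\<lambda>a b c d. E 1 4 a d) = diamond_sum (\<lambda>a b c d. E 1 4 a b)"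
    by (rule diamond_sum_swap[of "\<lambda>a b c d. E 1 4 a b"])
  \<comment> \<open>The side x3 x4 is opposite to x1 x2, so both symmetries are required.\<close>
  also have "diamond_sum (\<lambda>a b c d. E 3 4 c d) = diamond_sum (\<lambda>a b c d. E 3 4 a b)"
    using diamond_sum_reflect[of "\<lambda>a b c d. E 3 4 a d"] diamond_sum_swap[of "\<lambda>a b c d. E 3 4 a b"]
    by simp
  finally show ?thesis using side[of 1 2] side[of 3 2] side[of 3 4] side[of 1 4] by linarith
qed

end

section \<open>Normalised norms and the best constant\<close>

context odd_finite_field
begin

lemma plane_nonempty: "plane R \<noteq> {}"
  by (auto simp: plane_def)

lemma Lnorm_nonneg: "0 \<le> Lnorm R p f"
proof (cases "p = \<infinity>")
  case True
  obtain x where "x \<in> plane R" using plane_nonempty by auto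
  then have "\<bar>f x\<bar> \<le> Max ((\<lambda>x. \<bar>f x\<bar>) ` plane R)" by (intro Max_ge) auto
  then show ?thesis using True by (simp add: Lnorm_def)
qed (simp add: Lnorm_def)

text \<open>The formula includes p = \<infinity>: there \<open>real_of_ereal p\<close> is 0, so the
  exponent 1 / 0 is 0, and the power is 1 because a nonempty \<open>A\<close> makes the base
  nonzero.\<close>

lemma Lnorm_indicator:
  assumes "p \<in> {1..\<infinity>}" "A \<subseteq> plane R" "A \<noteq> {}"
  shows "Lnorm R p (indicator A) = (real (card A) / real q ^ 2) powr (1 / real_of_ereal p)"
proof (cases "p = \<infinity>")
  case True
  have "(\<lambda>x. \<bar>indicator A x :: real\<bar>) ` plane R \<subseteq> {0, 1}" by (auto simp: indicator_def)
  moreover have "1 \<in> (\<lambda>x. \<bar>indicator A x :: real\<bar>) ` plane R" using assms by force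
  ultimately have "Max ((\<lambda>x. \<bar>indicator A x :: real\<bar>) ` plane R) = 1" by (intro Max_eqI) auto
  moreover have "card A > 0" using assms by (meson card_gt_0_iff finite_plane finite_subset)
  ultimately show ?thesis using True q_pos by (simp add: Lnorm_def)
next
  case False
  then obtain r where r: "p = ereal r" "1 \<le> r" using assms by (cases p) auto
  have "(\<Sum>x\<in>plane R. \<bar>indicator A x\<bar> powr r) = (\<Sum>x\<in>A. 1)"
    using assms r by (intro sum.mono_neutral_cong_right) (auto simp: indicator_def)
  then show ?thesis using False r by (simp add: Lnorm_def)
qed

text \<open>For finite p and nonzero f the choice is v = (f / L)^(p / 3), so that f = L v^(3 / p)
  and the cubes of v sum to q^2. Every exponent is thereby reduced to one common normalisation; for
  p = \<infinity> or f = 0 the constant 1 serves.\<close>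

lemma Lnorm_majorant:
  assumes p: "p \<in> {1..\<infinity>}" and f: "\<And>x. x \<in> plane R \<Longrightarrow> 0 \<le> f x"
  obtains v where "\<And>x. x \<in> plane R \<Longrightarrow> 0 \<le> v x"
    "\<And>x. x \<in> plane R \<Longrightarrow> f x \<le> Lnorm R p f * v x powr (3 * (1 / real_of_ereal p))"
    "(\<Sum>x\<in>plane R. v x ^ 3) \<le> real q ^ 2"
proof (cases "p = \<infinity>")
  case True
  have "f x \<le> Lnorm R p f" if "x \<in> plane R" for x
  proof -
    have "\<bar>f x\<bar> \<le> Max ((\<lambda>x. \<bar>f x\<bar>) ` plane R)" using that by (intro Max_ge) auto
    then show ?thesis using True by (simp add: Lnorm_def)
  qed
  then show thesis using that[of "\<lambda>_. 1"] by (simp add: card_plane)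
next
  case False
  then obtain r where r: "p = ereal r" "1 \<le> r" using p by (cases p) auto
  define L A where "L = Lnorm R p f" and "A = (\<Sum>x\<in>plane R. f x powr r)"
  have L: "L = (A / real q ^ 2) powr (1 / r)"
    using f r by (simp add: L_def Lnorm_def A_def)
  have "0 \<le> A" unfolding A_def by (intro sum_nonneg) auto
  show thesis
  proof (cases "A = 0")
    case True
    then have "f x = 0" if "x \<in> plane R" for x
      using that unfolding A_def by (simp add: sum_nonneg_eq_0_iff)
    then show thesis using that[of "\<lambda>_. 1"] Lnorm_nonneg by (simp add: card_plane)
  next
    case False
    then have A: "0 < A" using \<open>0 \<le> A\<close> by simp
    then have L0: "0 < L" using q_pos by (simp add: L)
    have Lr: "L powr r = A / real q ^ 2" using r A q_pos by (simp add: L powr_powr)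
    define v where "v x = (f x / L) powr (r / 3)" for x
    have "v x powr (3 * (1 / r)) = f x / L" if "x \<in> plane R" for x
      using r f[OF that] L0 by (simp add: v_def powr_powr)
    moreover have "(\<Sum>x\<in>plane R. v x ^ 3) = real q ^ 2"
    proof -
      have "v x ^ 3 = f x powr r / L powr r" if "x \<in> plane R" for x
      proof -
        have "v x ^ 3 = v x powr 3" by (simp add: v_def)
        also have "\<dots> = (f x / L) powr r" by (simp add: v_def powr_powr)
        finally show ?thesis by (simp add: powr_divide)
      qed
      then have "(\<Sum>x\<in>plane R. v x ^ 3) = A / L powr r" by (simp add: A_def sum_divide_distrib)
      then show ?thesis using A q_pos by (simp add: Lr)
    qed
    ultimately show thesis using that[of v] L0 r by (simp add: v_def L_def)
  qed
qed

lemma Lnorm_majorant4: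
  assumes p: "p1 \<in> {1..\<infinity>}" "p2 \<in> {1..\<infinity>}" "p3 \<in> {1..\<infinity>}" "p4 \<in> {1..\<infinity>}"
    and f: "\<And>x. x \<in> plane R \<Longrightarrow> 0 \<le> f1 x \<and> 0 \<le> f2 x \<and> 0 \<le> f3 x \<and> 0 \<le> f4 x"
  shows "\<exists>v. (\<forall>i. \<forall>x\<in>plane R. 0 \<le> v i x) \<and> (\<forall>i. (\<Sum>x\<in>plane R. v i x ^ 3) \<le> real q ^ 2) \<and>
    (\<forall>a\<in>plane R. \<forall>b\<in>plane R. \<forall>c\<in>plane R. \<forall>d\<in>plane R.
      f1 a * f2 b * f3 c * f4 d \<le> (Lnorm R p1 f1 * Lnorm R p2 f2 * Lnorm R p3 f3 * Lnorm R p4 f4) *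
        (v (1::nat) a powr (3 * (1 / real_of_ereal p1)) * v 2 b powr (3 * (1 / real_of_ereal p2)) *
         v 3 c powr (3 * (1 / real_of_ereal p3)) * v 4 d powr (3 * (1 / real_of_ereal p4))))"
proof -
  obtain v1 where v1: "\<And>x. x \<in> plane R \<Longrightarrow> 0 \<le> v1 x"
    "\<And>x. x \<in> plane R \<Longrightarrow> f1 x \<le> Lnorm R p1 f1 * v1 x powr (3 * (1 / real_of_ereal p1))"
    "(\<Sum>x\<in>plane R. v1 x ^ 3) \<le> real q ^ 2" using Lnorm_majorant[OF p(1), of f1] f by auto
  obtain v2 where v2: "\<And>x. x \<in> plane R \<Longrightarrow> 0 \<le> v2 x"
    "\<And>x. x \<in> plane R \<Longrightarrow> f2 x \<le> Lnorm R p2 f2 * v2 x powr (3 * (1 / real_of_ereal p2))"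
    "(\<Sum>x\<in>plane R. v2 x ^ 3) \<le> real q ^ 2" using Lnorm_majorant[OF p(2), of f2] f by auto
  obtain v3 where v3: "\<And>x. x \<in> plane R \<Longrightarrow> 0 \<le> v3 x"
    "\<And>x. x \<in> plane R \<Longrightarrow> f3 x \<le> Lnorm R p3 f3 * v3 x powr (3 * (1 / real_of_ereal p3))"
    "(\<Sum>x\<in>plane R. v3 x ^ 3) \<le> real q ^ 2" using Lnorm_majorant[OF p(3), of f3] f by auto
  obtain v4 where v4: "\<And>x. x \<in> plane R \<Longrightarrow> 0 \<le> v4 x"
    "\<And>x. x \<in> plane R \<Longrightarrow> f4 x \<le> Lnorm R p4 f4 * v4 x powr (3 * (1 / real_of_ereal p4))"
    "(\<Sum>x\<in>plane R. v4 x ^ 3) \<le> real q ^ 2" using Lnorm_majorant[OF p(4), of f4] f by auto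
  define v where "v i = (if i = (1::nat) then v1 else if i = 2 then v2 else if i = 3 then v3 else v4)" for i
  show ?thesis
  proof (intro exI[of _ v] conjI allI ballI)
    show "0 \<le> v i x" if "x \<in> plane R" for i x
      using that v1 v2 v3 v4 by (simp add: v_def)
    show "(\<Sum>x\<in>plane R. v i x ^ 3) \<le> real q ^ 2" for i
      using v1 v2 v3 v4 by (simp add: v_def)
  next
    fix a b c d assume x: "a \<in> plane R" "b \<in> plane R" "c \<in> plane R" "d \<in> plane R"
    have "f1 a * f2 b * f3 c * f4 d \<le>
        (Lnorm R p1 f1 * v1 a powr (3 * (1 / real_of_ereal p1))) *
        (Lnorm R p2 f2 * v2 b powr (3 * (1 / real_of_ereal p2))) *
        (Lnorm R p3 f3 * v3 c powr (3 * (1 / real_of_ereal p3))) *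
        (Lnorm R p4 f4 * v4 d powr (3 * (1 / real_of_ereal p4)))"
      using x f by (intro mult_mono v1 v2 v3 v4 mult_nonneg_nonneg Lnorm_nonneg) auto
    then show "f1 a * f2 b * f3 c * f4 d \<le> (Lnorm R p1 f1 * Lnorm R p2 f2 * Lnorm R p3 f3 * Lnorm R p4 f4) *
        (v 1 a powr (3 * (1 / real_of_ereal p1)) * v 2 b powr (3 * (1 / real_of_ereal p2)) *
         v 3 c powr (3 * (1 / real_of_ereal p3)) * v 4 d powr (3 * (1 / real_of_ereal p4)))"
      by (simp add: v_def mult_ac)
  qed
qed

text \<open>The LEAST in \<^const>\<open>best_const\<close> is the infimum of the valid constants: these are bounded
  below by testing with constant functions, and validity is a closed condition.\<close>

lemma best_const_least:
  assumes p: "p1 \<in> {1..\<infinity>}" "p2 \<in> {1..\<infinity>}" "p3 \<in> {1..\<infinity>}" "p4 \<in> {1..\<infinity>}"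
    and K: "\<And>f1 f2 f3 f4. (\<And>x. x \<in> plane R \<Longrightarrow> 0 \<le> f1 x \<and> 0 \<le> f2 x \<and> 0 \<le> f3 x \<and> 0 \<le> f4 x) \<Longrightarrow>
      \<Phi> R t f1 f2 f3 f4 \<le> K * (Lnorm R p1 f1 * Lnorm R p2 f2 * Lnorm R p3 f3 * Lnorm R p4 f4)"
  shows "best_const \<Phi> R t p1 p2 p3 p4 \<le> K"
    and "(\<And>x. x \<in> plane R \<Longrightarrow> 0 \<le> f1 x \<and> 0 \<le> f2 x \<and> 0 \<le> f3 x \<and> 0 \<le> f4 x) \<Longrightarrow>
      \<Phi> R t f1 f2 f3 f4 \<le> best_const \<Phi> R t p1 p2 p3 p4 *
        (Lnorm R p1 f1 * Lnorm R p2 f2 * Lnorm R p3 f3 * Lnorm R p4 f4)"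
proof -
  define L where "L f1 f2 f3 f4 = Lnorm R p1 f1 * Lnorm R p2 f2 * Lnorm R p3 f3 * Lnorm R p4 f4"
    for f1 f2 f3 f4
  define valid where "valid C \<longleftrightarrow> (\<forall>f1 f2 f3 f4.
        (\<forall>x\<in>plane R. 0 \<le> f1 x \<and> 0 \<le> f2 x \<and> 0 \<le> f3 x \<and> 0 \<le> f4 x) \<longrightarrow>
        \<Phi> R t f1 f2 f3 f4 \<le> C * L f1 f2 f3 f4)" for C
  have best: "best_const \<Phi> R t p1 p2 p3 p4 = (LEAST C. valid C)"
    by (simp add: best_const_def valid_def L_def)
  have L_nonneg: "0 \<le> L f1 f2 f3 f4" for f1 f2 f3 f4
    unfolding L_def by (intro mult_nonneg_nonneg Lnorm_nonneg)
  have K: "valid K" unfolding valid_def L_def using K by blast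
  define e :: "'a \<times> 'a \<Rightarrow> real" where "e = indicator (plane R)"
  have "Lnorm R p e = 1" if "p \<in> {1..\<infinity>}" for p
    unfolding e_def using that plane_nonempty q_pos by (subst Lnorm_indicator) (auto simp: card_plane)
  then have "L e e e e = 1" using p by (simp add: L_def)
  then have below: "\<Phi> R t e e e e \<le> C" if "valid C" for C
    using that[unfolded valid_def, rule_format, of e e e e] by (simp add: e_def)
  define m where "m = Inf {C. valid C}"
  have bdd: "bdd_below {C. valid C}" using below by (intro bdd_belowI[of _ "\<Phi> R t e e e e"]) auto
  have m_le: "m \<le> C" if "valid C" for C unfolding m_def using that bdd by (auto intro: cInf_lower)
  have "valid m"
    unfolding valid_def
  proof (intro allI impI)
    fix f1 f2 f3 f4 :: "'a \<times> 'a \<Rightarrow> real"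
    assume f: "\<forall>x\<in>plane R. 0 \<le> f1 x \<and> 0 \<le> f2 x \<and> 0 \<le> f3 x \<and> 0 \<le> f4 x"
    have *: "\<Phi> R t f1 f2 f3 f4 \<le> C * L f1 f2 f3 f4" if "valid C" for C
      using that f by (simp add: valid_def)
    show "\<Phi> R t f1 f2 f3 f4 \<le> m * L f1 f2 f3 f4"
    proof (cases "L f1 f2 f3 f4 = 0")
      case True
      \<comment> \<open>When the product of norms is 0 no quotient can be formed, but the valid
        constant \<open>K\<close> already shows that the form is at most 0.\<close>
      then show ?thesis using *[OF K] by simp
    next
      case False
      then have pos: "0 < L f1 f2 f3 f4" using L_nonneg[of f1 f2 f3 f4] by simp
      then have "\<Phi> R t f1 f2 f3 f4 / L f1 f2 f3 f4 \<le> m"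
        unfolding m_def using K * by (intro cInf_greatest) (auto simp: divide_le_eq)
      then show ?thesis using pos by (simp add: divide_le_eq)
    qed
  qed
  then have "(LEAST C. valid C) = m" using m_le by (intro Least_equality) auto
  then have b: "best_const \<Phi> R t p1 p2 p3 p4 = m" using best by simp
  show "best_const \<Phi> R t p1 p2 p3 p4 \<le> K" using m_le[OF K] b by simp
  show "\<Phi> R t f1 f2 f3 f4 \<le> best_const \<Phi> R t p1 p2 p3 p4 *
        (Lnorm R p1 f1 * Lnorm R p2 f2 * Lnorm R p3 f3 * Lnorm R p4 f4)"
    if "\<And>x. x \<in> plane R \<Longrightarrow> 0 \<le> f1 x \<and> 0 \<le> f2 x \<and> 0 \<le> f3 x \<and> 0 \<le> f4 x"
    using \<open>valid m\<close> that unfolding b valid_def L_def by blast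
qed

end

section \<open>The two operators\<close>

context circle_field
begin

sublocale sparse_graph "plane R" S "real q" s
proof
  show "S x y = 0 \<or> S x y = 1" for x y by (simp add: S_def indicator_def)
  show "1 \<le> real q" using q_pos by simp
  show "S x y = S y x" if "x \<in> plane R" "y \<in> plane R" for x y using that by (rule S_sym)
  show "(\<Sum>z\<in>plane R. S x z * S z y) \<le> 2" if "x \<in> plane R" "y \<in> plane R" "x \<noteq> y" for x y
    using that by (rule S_codegree)
qed (simp_all add: S_irrefl S_degree card_plane)

lemma C4_diag_op_eq:
  "C4_diag_op R t f1 f2 f3 f4 = 1 / (real q ^ 2 * s) * diamond_sum (\<lambda>a b c d. f1 a * f2 b * f3 c * f4 d)"
  by (simp add: C4_diag_op_def Let_def S_def diamond_sum_def)

text \<open>Normalisation turns q^3 into q / s. For a nonempty circle, q <= s + 3 and 1 <= s give q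
  <= 4 s, whence 3520 = 4 * 880.\<close>

lemma C4_diag_op_le:
  assumes "diamond_sum (\<lambda>a b c d. f1 a * f2 b * f3 c * f4 d) \<le> 880 * real q ^ 3 * L" "0 \<le> L"
  shows "C4_diag_op R t f1 f2 f3 f4 \<le> 3520 * L"
proof (cases "circle R t = {}")
  case True
  \<comment> \<open>For an empty circle the prefactor is 1 / 0 = 0, so the operator
    vanishes.\<close>
  then show ?thesis using assms(2) by (simp add: C4_diag_op_eq)
next
  case False
  then have "q \<le> card (circle R t) + 3" "1 \<le> card (circle R t)"
    using card_circle_ge by (simp_all add: Suc_le_eq card_gt_0_iff)
  then have s: "real q \<le> 4 * s" "1 \<le> s" by linarith+
  have "C4_diag_op R t f1 f2 f3 f4 \<le> 1 / (real q ^ 2 * s) * (880 * real q ^ 3 * L)"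
    unfolding C4_diag_op_eq using assms(1) by (intro mult_left_mono) auto
  also have "\<dots> = 880 * L * (real q / s)"
    using q_pos s by (simp add: power2_eq_square power3_eq_cube)
  also have "\<dots> \<le> 880 * L * 4"
    using s assms(2) by (intro mult_left_mono) (auto simp: divide_le_eq)
  finally show ?thesis by simp
qed

lemma best_const_C4_diag_op_le:
  assumes p: "p1 \<in> {1..\<infinity>}" "p2 \<in> {1..\<infinity>}" "p3 \<in> {1..\<infinity>}" "p4 \<in> {1..\<infinity>}"
    and u: "u1 = 1 / real_of_ereal p1" "u2 = 1 / real_of_ereal p2" "u3 = 1 / real_of_ereal p3"
      "u4 = 1 / real_of_ereal p4"
      "2 * (u1 + u3) + (u2 + u4) \<le> 2" "(u1 + u3) + 2 * (u2 + u4) \<le> 2"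
  shows "best_const C4_diag_op R t p1 p2 p3 p4 \<le> 3520"
proof (intro best_const_least[OF p] C4_diag_op_le mult_nonneg_nonneg Lnorm_nonneg)
  fix f1 f2 f3 f4 :: "'a \<times> 'a \<Rightarrow> real"
  assume f: "\<And>x. x \<in> plane R \<Longrightarrow> 0 \<le> f1 x \<and> 0 \<le> f2 x \<and> 0 \<le> f3 x \<and> 0 \<le> f4 x"
  have u_nonneg: "0 \<le> 1 / real_of_ereal r" if "r \<in> {1..\<infinity>}" for r
    using that by (cases r) auto
  define L where "L = Lnorm R p1 f1 * Lnorm R p2 f2 * Lnorm R p3 f3 * Lnorm R p4 f4"
  have "0 \<le> L" unfolding L_def by (intro mult_nonneg_nonneg Lnorm_nonneg)
  obtain v where v: "\<And>i x. x \<in> plane R \<Longrightarrow> 0 \<le> v i x" "\<And>i. (\<Sum>x\<in>plane R. v i x ^ 3) \<le> real q ^ 2"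
    "\<And>a b c d. a \<in> plane R \<Longrightarrow> b \<in> plane R \<Longrightarrow> c \<in> plane R \<Longrightarrow> d \<in> plane R \<Longrightarrow>
      f1 a * f2 b * f3 c * f4 d \<le> L * (v (1::nat) a powr (3 * u1) * v 2 b powr (3 * u2) *
         v 3 c powr (3 * u3) * v 4 d powr (3 * u4))"
    using Lnorm_majorant4[of p1 p2 p3 p4 f1 f2 f3 f4, OF p f, folded L_def u(1-4)] by blast
  have "diamond_sum (\<lambda>a b c d. f1 a * f2 b * f3 c * f4 d) \<le>
      L * diamond_sum (\<lambda>a b c d. v (1::nat) a powr (3 * u1) * v 2 b powr (3 * u2) *
         v 3 c powr (3 * u3) * v 4 d powr (3 * u4))"
    unfolding diamond_sum_cmult[symmetric] by (intro diamond_sum_mono v(3))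
  also have "\<dots> \<le> L * (880 * real q ^ 3)"
    using \<open>0 \<le> L\<close> v(1,2) u_nonneg p u
    by (intro mult_left_mono diamond_sum_powr_le) auto
  finally show "diamond_sum (\<lambda>a b c d. f1 a * f2 b * f3 c * f4 d) \<le> 880 * real q ^ 3 * L"
    by (simp add: mult_ac)
qed

text \<open>Here u1 + u3 = 4/3 lies outside the polytope. The chord x1 x3, an edge absent from the
  plain 4-cycle, allows \<open>bilinear_bound\<close> to be applied to f1 and f3 directly.\<close>

lemma best_const_C4_diag_op_diagonal_le:
  "best_const C4_diag_op R t (ereal (3/2)) \<infinity> (ereal (3/2)) \<infinity> \<le> 3520"
proof (intro best_const_least C4_diag_op_le mult_nonneg_nonneg Lnorm_nonneg)
  fix f1 f2 f3 f4 :: "'a \<times> 'a \<Rightarrow> real"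
  assume f: "\<And>x. x \<in> plane R \<Longrightarrow> 0 \<le> f1 x \<and> 0 \<le> f2 x \<and> 0 \<le> f3 x \<and> 0 \<le> f4 x"
  have p: "ereal (3/2) \<in> {1..\<infinity>}" "(\<infinity>::ereal) \<in> {1..\<infinity>}"
    by (simp_all add: one_ereal_def)
  define L where "L = Lnorm R (ereal (3/2)) f1 * Lnorm R \<infinity> f2 * Lnorm R (ereal (3/2)) f3 * Lnorm R \<infinity> f4"
  have "0 \<le> L" unfolding L_def by (intro mult_nonneg_nonneg Lnorm_nonneg)
  obtain v where v: "\<And>i x. x \<in> plane R \<Longrightarrow> 0 \<le> v i x" "\<And>i. (\<Sum>x\<in>plane R. v i x ^ 3) \<le> real q ^ 2"
    "\<And>a b c d. a \<in> plane R \<Longrightarrow> b \<in> plane R \<Longrightarrow> c \<in> plane R \<Longrightarrow> d \<in> plane R \<Longrightarrow>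
      f1 a * f2 b * f3 c * f4 d \<le> L * (v (1::nat) a powr (3 * (1 / real_of_ereal (ereal (3/2)))) *
         v 2 b powr (3 * (1 / real_of_ereal \<infinity>)) * v 3 c powr (3 * (1 / real_of_ereal (ereal (3/2)))) *
         v 4 d powr (3 * (1 / real_of_ereal \<infinity>)))"
    using Lnorm_majorant4[of "ereal (3/2)" \<infinity> "ereal (3/2)" \<infinity> f1 f2 f3 f4, OF p p f, folded L_def] by blast
  have "diamond_sum (\<lambda>a b c d. f1 a * f2 b * f3 c * f4 d) \<le>
      diamond_sum (\<lambda>a b c d. L * (v 1 a ^ 2 * v 3 c ^ 2))"
  proof (intro diamond_sum_mono)
    fix a b c d assume x: "a \<in> plane R" "b \<in> plane R" "c \<in> plane R" "d \<in> plane R"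
    \<comment> \<open>The exponents come from 3 / (3/2) = 2 and, at \<infinity>, 3 * (1 / 0) = 0. A
      power with exponent 0 is 1 or, at base 0, 0; in both cases at most 1.\<close>
    have "v 1 a powr 2 * v 2 b powr 0 * v 3 c powr 2 * v 4 d powr 0 \<le> v 1 a ^ 2 * v 3 c ^ 2"
      using x v(1) by simp
    then show "f1 a * f2 b * f3 c * f4 d \<le> L * (v 1 a ^ 2 * v 3 c ^ 2)"
      using order_trans[OF v(3)[OF x] mult_left_mono[OF _ \<open>0 \<le> L\<close>]] by simp
  qed
  also have "\<dots> \<le> L * (4 * (49 * real q ^ 3))"
    unfolding diamond_sum_cmult
    using v(1,2) order_trans[OF diamond_sum_diagonal_le mult_left_mono[OF bilinear_bound]] \<open>0 \<le> L\<close>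
    by (intro mult_left_mono) auto
  also have "\<dots> \<le> 880 * real q ^ 3 * L" using \<open>0 \<le> L\<close> by (simp add: mult_ac mult_left_mono)
  finally show "diamond_sum (\<lambda>a b c d. f1 a * f2 b * f3 c * f4 d) \<le> 880 * real q ^ 3 * L" .
qed (simp_all add: one_ereal_def)

section \<open>Test functions for the 4-cycle operator\<close>

lemma C4_op_eq:
  "C4_op R t f1 f2 f3 f4 = 1 / (real q ^ 2 * s ^ 2) *
     (\<Sum>x1\<in>plane R. \<Sum>x2\<in>plane R. \<Sum>x3\<in>plane R. \<Sum>x4\<in>plane R.
        S x1 x2 * S x2 x3 * S x3 x4 * S x4 x1 * (f1 x1 * f2 x2 * f3 x3 * f4 x4))"
  by (simp add: C4_op_def Let_def S_def)

text \<open>The LEAST is known to be a valid constant only once some valid constant exists, and one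
  that depends on the field suffices. A crude one arises by bounding every power of the majorants by
  M = q^6.\<close>

lemma C4_op_le_best_const:
  assumes p: "p1 \<in> {1..\<infinity>}" "p2 \<in> {1..\<infinity>}" "p3 \<in> {1..\<infinity>}" "p4 \<in> {1..\<infinity>}"
    and f: "\<And>x. x \<in> plane R \<Longrightarrow> 0 \<le> f1 x \<and> 0 \<le> f2 x \<and> 0 \<le> f3 x \<and> 0 \<le> f4 x"
  shows "C4_op R t f1 f2 f3 f4 \<le> best_const C4_op R t p1 p2 p3 p4 *
        (Lnorm R p1 f1 * Lnorm R p2 f2 * Lnorm R p3 f3 * Lnorm R p4 f4)"
proof (rule best_const_least(2)[OF p _ f])
  fix f1 f2 f3 f4 :: "'a \<times> 'a \<Rightarrow> real"
  assume f: "\<And>x. x \<in> plane R \<Longrightarrow> 0 \<le> f1 x \<and> 0 \<le> f2 x \<and> 0 \<le> f3 x \<and> 0 \<le> f4 x"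
  define L where "L = Lnorm R p1 f1 * Lnorm R p2 f2 * Lnorm R p3 f3 * Lnorm R p4 f4"
  have "0 \<le> L" unfolding L_def by (intro mult_nonneg_nonneg Lnorm_nonneg)
  define M where "M = (real q ^ 2) powr 3"
  obtain v where v: "\<And>i x. x \<in> plane R \<Longrightarrow> 0 \<le> v i x" "\<And>i. (\<Sum>x\<in>plane R. v i x ^ 3) \<le> real q ^ 2"
    "\<And>a b c d. a \<in> plane R \<Longrightarrow> b \<in> plane R \<Longrightarrow> c \<in> plane R \<Longrightarrow> d \<in> plane R \<Longrightarrow>
      f1 a * f2 b * f3 c * f4 d \<le> L *
        (v (1::nat) a powr (3 * (1 / real_of_ereal p1)) * v 2 b powr (3 * (1 / real_of_ereal p2)) *
         v 3 c powr (3 * (1 / real_of_ereal p3)) * v 4 d powr (3 * (1 / real_of_ereal p4)))"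
    using Lnorm_majorant4[of p1 p2 p3 p4 f1 f2 f3 f4, OF p f, folded L_def] by blast
  have vM: "v i x powr (3 * (1 / real_of_ereal r)) \<le> M" if "x \<in> plane R" "r \<in> {1..\<infinity>}" for i x r
  proof -
    have u: "0 \<le> 1 / real_of_ereal r" "1 / real_of_ereal r \<le> 1" using that(2) by (cases r; auto)+
    have "v i x ^ 3 \<le> (\<Sum>x\<in>plane R. v i x ^ 3)"
      using that v(1) by (intro member_le_sum) auto
    then have 3: "v i x ^ 3 \<le> real q ^ 2" using v(2)[of i] by simp
    have "v i x \<le> real q ^ 2"
    proof (cases "1 \<le> v i x")
      case True
      then have "v i x ^ 1 \<le> v i x ^ 3" by (intro power_increasing) auto
      then show ?thesis using 3 by simp
    qed (use q_pos in \<open>auto intro: order_trans[of _ 1]\<close>)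
    then have "v i x powr (3 * (1 / real_of_ereal r)) \<le> (real q ^ 2) powr (3 * (1 / real_of_ereal r))"
      using that v(1) u by (intro powr_mono2) auto
    also have "\<dots> \<le> M" unfolding M_def using u q_pos by (intro powr_mono) auto
    finally show ?thesis .
  qed
  define N where "N = (\<Sum>x1\<in>plane R. \<Sum>x2\<in>plane R. \<Sum>x3\<in>plane R. \<Sum>x4\<in>plane R.
        S x1 x2 * S x2 x3 * S x3 x4 * S x4 x1 * (M * M * M * M))"
  have "C4_op R t f1 f2 f3 f4 \<le> 1 / (real q ^ 2 * s ^ 2) *
     (\<Sum>x1\<in>plane R. \<Sum>x2\<in>plane R. \<Sum>x3\<in>plane R. \<Sum>x4\<in>plane R.
        S x1 x2 * S x2 x3 * S x3 x4 * S x4 x1 * (L * (M * M * M * M)))"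
    unfolding C4_op_eq
  proof (intro mult_left_mono sum_mono)
    fix a b c d assume x: "a \<in> plane R" "b \<in> plane R" "c \<in> plane R" "d \<in> plane R"
    have "L * (v (1::nat) a powr (3 * (1 / real_of_ereal p1)) * v 2 b powr (3 * (1 / real_of_ereal p2)) *
         v 3 c powr (3 * (1 / real_of_ereal p3)) * v 4 d powr (3 * (1 / real_of_ereal p4)))
       \<le> L * (M * M * M * M)"
      using x p \<open>0 \<le> L\<close> by (intro mult_left_mono mult_mono vM mult_nonneg_nonneg) (auto simp: M_def)
    then show "f1 a * f2 b * f3 c * f4 d \<le> L * (M * M * M * M)" using v(3)[OF x] by simp
  qed (auto intro!: mult_nonneg_nonneg S_nonneg)
  also have "\<dots> = 1 / (real q ^ 2 * s ^ 2) * (L * N)"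
    unfolding N_def by (simp add: sum_distrib_left mult_ac)
  finally show "C4_op R t f1 f2 f3 f4 \<le> (1 / (real q ^ 2 * s ^ 2) * N) * L" by (simp add: mult_ac)
qed

abbreviation "origin \<equiv> (\<zero>, \<zero>)"

lemma S_origin: "x \<in> plane R \<Longrightarrow> S x origin = indicator (circle R t) x"
  "x \<in> plane R \<Longrightarrow> S origin x = indicator (circle R t) x"
proof -
  assume x: "x \<in> plane R"
  have "vdiff R x origin = x" using x by (auto simp: vdiff_def plane_def minus_eq)
  then show "S x origin = indicator (circle R t) x" by (simp add: S_def)
  then show "S origin x = indicator (circle R t) x" using S_sym[of x origin] x by (simp add: plane_def)
qed

lemma sum_indicator_circle: "(\<Sum>x\<in>plane R. indicator (circle R t) x :: real) = s"
proof -
  have "(\<Sum>x\<in>plane R. indicator (circle R t) x :: real) = (\<Sum>x\<in>circle R t. 1)"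
    by (intro sum.mono_neutral_cong_right) (auto simp: circle_def)
  then show ?thesis by simp
qed

text \<open>With two opposite vertices fixed at the origin, the other two run independently over the
  circle. These s^2 configurations cancel the s^2 in the prefactor, which is nonzero as the circle
  is nonempty.\<close>

lemma C4_op_test:
  assumes "circle R t \<noteq> {}"
  shows "C4_op R t (indicator {origin}) (indicator (circle R t)) (indicator {origin}) (indicator (circle R t))
      = 1 / real q ^ 2" (is "?A = _")
    and "C4_op R t (indicator (circle R t)) (indicator {origin}) (indicator (circle R t)) (indicator {origin})
      = 1 / real q ^ 2" (is "?B = _")
proof -
  let ?P = "plane R" and ?g = "indicator (circle R t) :: 'a \<times> 'a \<Rightarrow> real"
    and ?d = "indicator {origin} :: 'a \<times> 'a \<Rightarrow> real"
  have o: "origin \<in> ?P" by (simp add: plane_def)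
  have delta: "(\<Sum>x\<in>?P. F x * ?d x) = F origin" for F
    using o by (simp add: indicator_def sum.delta if_distrib cong: if_cong)
  have s: "s \<noteq> 0" using assms by simp
  have "(\<Sum>x1\<in>?P. \<Sum>x2\<in>?P. \<Sum>x3\<in>?P. \<Sum>x4\<in>?P.
      S x1 x2 * S x2 x3 * S x3 x4 * S x4 x1 * (?d x1 * ?g x2 * ?d x3 * ?g x4))
    = (\<Sum>x1\<in>?P. (\<Sum>x2\<in>?P. \<Sum>x3\<in>?P. (\<Sum>x4\<in>?P.
      S x1 x2 * S x2 x3 * S x3 x4 * S x4 x1 * (?g x2 * ?g x4)) * ?d x3) * ?d x1)"
    by (simp add: sum_distrib_left sum_distrib_right mult_ac)
  also have "\<dots> = (\<Sum>x2\<in>?P. \<Sum>x4\<in>?P. S origin x2 * S x2 origin * S origin x4 * S x4 origin * (?g x2 * ?g x4))"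
    by (simp only: delta)
  also have "\<dots> = (\<Sum>x2\<in>?P. \<Sum>x4\<in>?P. ?g x2 * ?g x4)"
    by (intro sum.cong refl) (auto simp: S_origin indicator_def)
  also have "\<dots> = s ^ 2" by (simp only: sum_product[symmetric] sum_indicator_circle power2_eq_square)
  finally show "?A = 1 / real q ^ 2" unfolding C4_op_eq using s by simp
  have "(\<Sum>x1\<in>?P. \<Sum>x2\<in>?P. \<Sum>x3\<in>?P. \<Sum>x4\<in>?P.
      S x1 x2 * S x2 x3 * S x3 x4 * S x4 x1 * (?g x1 * ?d x2 * ?g x3 * ?d x4))
    = (\<Sum>x1\<in>?P. \<Sum>x2\<in>?P. (\<Sum>x3\<in>?P. \<Sum>x4\<in>?P.
      (S x1 x2 * S x2 x3 * S x3 x4 * S x4 x1 * (?g x1 * ?g x3)) * ?d x4) * ?d x2)"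
    by (simp add: sum_distrib_left sum_distrib_right mult_ac)
  also have "\<dots> = (\<Sum>x1\<in>?P. \<Sum>x3\<in>?P. S x1 origin * S origin x3 * S x3 origin * S origin x1 * (?g x1 * ?g x3))"
    by (simp only: delta)
  also have "\<dots> = (\<Sum>x2\<in>?P. \<Sum>x4\<in>?P. ?g x2 * ?g x4)"
    by (intro sum.cong refl) (auto simp: S_origin indicator_def)
  also have "\<dots> = s ^ 2" by (simp only: sum_product[symmetric] sum_indicator_circle power2_eq_square)
  finally show "?B = 1 / real q ^ 2" unfolding C4_op_eq using s by simp
qed

text \<open>The circle has at most 2 q points, which gives (2 / q)^u <= 2 q^(-u) because 0 <= u <=
  1.\<close>

lemma Lnorm_test:
  assumes "p \<in> {1..\<infinity>}" and u: "u = 1 / real_of_ereal p" and "circle R t \<noteq> {}"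
  shows "Lnorm R p (indicator {origin}) = real q powr (- 2 * u)"
    and "Lnorm R p (indicator (circle R t)) \<le> 2 * real q powr (- u)"
proof -
  have u01: "0 \<le> u" "u \<le> 1" unfolding u using assms(1) by (cases p; auto)+
  have q0: "0 < real q" using q_pos by simp
  have "Lnorm R p (indicator {origin}) = (1 / real q powr 2) powr u"
    using assms(1) q0 by (subst Lnorm_indicator) (auto simp: plane_def u)
  also have "\<dots> = real q powr (- 2 * u)"
    using q0 by (simp only: powr_minus_divide[symmetric] powr_powr)
  finally show "Lnorm R p (indicator {origin}) = real q powr (- 2 * u)" .
  have "Lnorm R p (indicator (circle R t)) = (s / real q ^ 2) powr u"
    using assms by (subst Lnorm_indicator) (auto simp: circle_def)
  also have "\<dots> \<le> (2 * real q / real q ^ 2) powr u"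
    using u01 degree_le by (intro powr_mono2 divide_right_mono) auto
  also have "\<dots> = (2 * real q powr (- 1)) powr u"
    using q0 by (simp add: power2_eq_square powr_minus_divide)
  also have "\<dots> = 2 powr u * real q powr (- u)"
    unfolding powr_mult powr_powr by simp
  also have "\<dots> \<le> 2 powr 1 * real q powr (- u)"
    using u01 by (intro mult_right_mono powr_mono) auto
  finally show "Lnorm R p (indicator (circle R t)) \<le> 2 * real q powr (- u)" by simp
qed

text \<open>The tests give 1 / q^2 <= C * 4 q^(-e), where the 4 comes from the two circle norms and
  e is the respective linear form in the u's. Multiplication by q^e gives the claim.\<close>

lemma C4_op_necessary:
  assumes p: "p1 \<in> {1..\<infinity>}" "p2 \<in> {1..\<infinity>}" "p3 \<in> {1..\<infinity>}" "p4 \<in> {1..\<infinity>}"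
    and u: "u1 = 1 / real_of_ereal p1" "u2 = 1 / real_of_ereal p2" "u3 = 1 / real_of_ereal p3"
      "u4 = 1 / real_of_ereal p4"
    and "circle R t \<noteq> {}" and C: "best_const C4_op R t p1 p2 p3 p4 \<le> C" "0 \<le> C"
  shows "real q powr (2 * (u1 + u3) + (u2 + u4) - 2) \<le> 4 * C"
    and "real q powr ((u1 + u3) + 2 * (u2 + u4) - 2) \<le> 4 * C"
proof -
  let ?g = "indicator (circle R t) :: 'a \<times> 'a \<Rightarrow> real" and ?d = "indicator {origin} :: 'a \<times> 'a \<Rightarrow> real"
  have q0: "0 < real q" using q_pos by simp
  have scale: "real q powr (e - 2) \<le> 4 * C" if "1 / real q ^ 2 \<le> C * L" "L \<le> 4 * real q powr (- e)" for e L
  proof -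
    have "real q powr (- 2) = 1 / real q ^ 2"
      using q0 by (simp add: powr_minus_divide)
    also have "\<dots> \<le> C * (4 * real q powr (- e))"
      using that C(2) mult_left_mono order_trans by blast
    finally have "real q powr (- 2) * real q powr e \<le> C * (4 * real q powr (- e)) * real q powr e"
      by (intro mult_right_mono) auto
    then show ?thesis using q0 by (simp add: mult.assoc flip: powr_add)
  qed
  have 1: "C4_op R t f1 f2 f3 f4 \<le> C * (Lnorm R p1 f1 * Lnorm R p2 f2 * Lnorm R p3 f3 * Lnorm R p4 f4)"
    if "\<And>x. x \<in> plane R \<Longrightarrow> 0 \<le> f1 x \<and> 0 \<le> f2 x \<and> 0 \<le> f3 x \<and> 0 \<le> f4 x" for f1 f2 f3 f4
    using order_trans[OF C4_op_le_best_const[OF p that] mult_right_mono[OF C(1)]]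
    by (simp add: Lnorm_nonneg)
  note N = Lnorm_test[OF _ _ \<open>circle R t \<noteq> {}\<close>]
  show "real q powr (2 * (u1 + u3) + (u2 + u4) - 2) \<le> 4 * C"
  proof (rule scale)
    show "1 / real q ^ 2 \<le> C * (Lnorm R p1 ?d * Lnorm R p2 ?g * Lnorm R p3 ?d * Lnorm R p4 ?g)"
      using 1[of ?d ?g ?d ?g] C4_op_test(1) assms by simp
    have "Lnorm R p1 ?d * Lnorm R p2 ?g * Lnorm R p3 ?d * Lnorm R p4 ?g
        \<le> real q powr (- 2 * u1) * (2 * real q powr (- u2)) * real q powr (- 2 * u3) * (2 * real q powr (- u4))"
      using N[OF p(1) u(1)] N[OF p(2) u(2)] N[OF p(3) u(3)] N[OF p(4) u(4)]
      by (intro mult_mono mult_nonneg_nonneg Lnorm_nonneg) auto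
    also have "\<dots> = 4 * real q powr (- (2 * (u1 + u3) + (u2 + u4)))"
      by (simp add: algebra_simps flip: powr_add)
    finally show "Lnorm R p1 ?d * Lnorm R p2 ?g * Lnorm R p3 ?d * Lnorm R p4 ?g
        \<le> 4 * real q powr (- (2 * (u1 + u3) + (u2 + u4)))" .
  qed
  show "real q powr ((u1 + u3) + 2 * (u2 + u4) - 2) \<le> 4 * C"
  proof (rule scale)
    show "1 / real q ^ 2 \<le> C * (Lnorm R p1 ?g * Lnorm R p2 ?d * Lnorm R p3 ?g * Lnorm R p4 ?d)"
      using 1[of ?g ?d ?g ?d] C4_op_test(2) assms by simp
    have "Lnorm R p1 ?g * Lnorm R p2 ?d * Lnorm R p3 ?g * Lnorm R p4 ?d
        \<le> (2 * real q powr (- u1)) * real q powr (- 2 * u2) * (2 * real q powr (- u3)) * real q powr (- 2 * u4)"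
      using N[OF p(1) u(1)] N[OF p(2) u(2)] N[OF p(3) u(3)] N[OF p(4) u(4)]
      by (intro mult_mono mult_nonneg_nonneg Lnorm_nonneg) auto
    also have "\<dots> = 4 * real q powr (- ((u1 + u3) + 2 * (u2 + u4)))"
      by (simp add: algebra_simps flip: powr_add)
    finally show "Lnorm R p1 ?g * Lnorm R p2 ?d * Lnorm R p3 ?g * Lnorm R p4 ?d
        \<le> 4 * real q powr (- ((u1 + u3) + 2 * (u2 + u4)))" .
  qed
qed

end

section \<open>Arbitrarily large admissible fields\<close>

text \<open>\<open>uniformly_bounded\<close> ranges over records of type \<open>nat ring\<close>, so
  the prime fields are realised on the naturals below p.\<close>

definition nat_residue_ring :: "nat \<Rightarrow> nat ring" where
  "nat_residue_ring p = \<lparr>carrier = {..<p}, monoid.mult = \<lambda>x y. x * y mod p, one = 1, zero = 0,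
     add = \<lambda>x y. (x + y) mod p\<rparr>"

lemma field_nat_residue_ring:
  assumes "prime p"
  shows "field (nat_residue_ring p)"
proof -
  have p: "p > 1" using assms prime_gt_1_nat by blast
  let ?R = "nat_residue_ring p"
  interpret cring ?R
  proof (rule cringI)
    show "abelian_group ?R"
    proof (rule abelian_groupI)
      fix x assume "x \<in> carrier ?R"
      \<comment> \<open>The case x = 0 is separate because p itself is not in the carrier.\<close>
      then have "(if x = 0 then 0 else p - x) \<in> carrier ?R"
        "(if x = 0 then 0 else p - x) \<oplus>\<^bsub>?R\<^esub> x = \<zero>\<^bsub>?R\<^esub>"
        by (auto simp: nat_residue_ring_def)
      then show "\<exists>y\<in>carrier ?R. y \<oplus>\<^bsub>?R\<^esub> x = \<zero>\<^bsub>?R\<^esub>" by blast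
    qed (use p in \<open>auto simp: nat_residue_ring_def mod_simps add_ac\<close>)
    show "comm_monoid ?R"
      by unfold_locales (use p in \<open>auto simp: nat_residue_ring_def mod_simps mult_ac\<close>)
  qed (use p in \<open>auto simp: nat_residue_ring_def mod_simps algebra_simps\<close>)
  show ?thesis
  proof (rule cring_fieldI2)
    show "\<zero>\<^bsub>?R\<^esub> \<noteq> \<one>\<^bsub>?R\<^esub>" by (simp add: nat_residue_ring_def)
    fix a assume "a \<in> carrier ?R" "a \<noteq> \<zero>\<^bsub>?R\<^esub>"
    then have "0 < a" "a < p" by (auto simp: nat_residue_ring_def)
    then have "coprime a p" using assms by (meson coprime_commute dvd_imp_le not_le prime_imp_coprime)
    then obtain b where "[a * b = Suc 0] (mod p)" using cong_solve_coprime_nat by blast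
    then have "a \<otimes>\<^bsub>?R\<^esub> (b mod p) = \<one>\<^bsub>?R\<^esub>" "b mod p \<in> carrier ?R"
      using p by (auto simp: nat_residue_ring_def cong_def mod_simps)
    then show "\<exists>b\<in>carrier ?R. a \<otimes>\<^bsub>?R\<^esub> b = \<one>\<^bsub>?R\<^esub>" by blast
  qed
qed

text \<open>With \<open>m = (N + 3)!\<close>, a prime divisor \<open>p\<close> of \<open>3 m\<^sup>2 - 1\<close> exceeds \<open>N\<close>, and modulo \<open>p\<close> the inverse
  \<open>3 m\<close> of \<open>m\<close> is a square root of \<open>3\<close>.\<close>

lemma admissible_fields_unbounded:
  "\<exists>F :: nat ring. admissible_field F \<and> N < card (carrier F)"
proof -
  \<comment> \<open>The summand 3 forces p > 3, so p is odd and 3 is its own nonzero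
    residue.\<close>
  define m where "m = (fact (N + 3) :: nat)"
  have "m \<ge> 1" by (simp add: m_def)
  then have "3 * m ^ 2 - 1 \<noteq> 1" using one_le_power[of m 2] by linarith
  then obtain p where p: "prime p" "p dvd 3 * m ^ 2 - 1" using prime_factor_nat by blast
  have large: "N + 3 < p"
  proof (rule ccontr)
    assume "\<not> N + 3 < p"
    then have "p dvd m" unfolding m_def using p prime_ge_1_nat by (intro dvd_fact) auto
    then have "p dvd 3 * m ^ 2" by (simp add: power2_eq_square)
    then have "p dvd 3 * m ^ 2 - (3 * m ^ 2 - 1)" using p(2) dvd_diff_nat by blast
    moreover have "3 * m ^ 2 - (3 * m ^ 2 - 1) = 1"
      using \<open>m \<ge> 1\<close> one_le_power[of m 2] by linarith
    ultimately show False using p(1) by auto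
  qed
  let ?R = "nat_residue_ring p"
  interpret field ?R using p(1) by (rule field_nat_residue_ring)
  have three: "[(3::nat)] \<cdot>\<^bsub>?R\<^esub> \<one>\<^bsub>?R\<^esub> = 3"
    using large by (simp add: numeral_3_eq_3 add.nat_pow_Suc) (simp add: nat_residue_ring_def)
  have cong: "[3 * m ^ 2 = 1] (mod p)"
  proof -
    have "3 * m ^ 2 = 1 + (3 * m ^ 2 - 1)" using \<open>m \<ge> 1\<close> one_le_power[of m 2] by linarith
    then show ?thesis using p(2) by (metis cong_add_lcancel_0_nat cong_0_iff)
  qed
  define r where "r = 3 * m mod p"
  have "r * r mod p = (3 * m) * (3 * m) mod p" by (simp only: r_def mod_mult_eq)
  also have "\<dots> = 3 * (3 * m ^ 2) mod p" by (simp add: power2_eq_square mult_ac)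
  also have "\<dots> = 3 * 1 mod p"
    using cong by (metis cong_def mod_mult_right_eq)
  also have "\<dots> = 3" using large by simp
  finally have "r \<otimes>\<^bsub>?R\<^esub> r = [(3::nat)] \<cdot>\<^bsub>?R\<^esub> \<one>\<^bsub>?R\<^esub>" unfolding three by (simp add: nat_residue_ring_def)
  moreover have "r \<in> carrier ?R" using large by (simp add: r_def nat_residue_ring_def)
  moreover have "card (carrier ?R) = p ^ 1" "finite (carrier ?R)" by (simp_all add: nat_residue_ring_def)
  moreover have "odd p" using large p(1) prime_odd_nat by simp
  moreover have "[(3::nat)] \<cdot>\<^bsub>?R\<^esub> \<one>\<^bsub>?R\<^esub> \<noteq> \<zero>\<^bsub>?R\<^esub>" unfolding three by (simp add: nat_residue_ring_def)
  ultimately have "admissible_field ?R"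
    unfolding admissible_field_def using field_axioms p(1) by blast
  moreover have "N < card (carrier ?R)" using large by (simp add: nat_residue_ring_def)
  ultimately show ?thesis by blast
qed

lemma admissible_field_imp_circle_field:
  assumes "admissible_field F" "t \<in> carrier F - {\<zero>\<^bsub>F\<^esub>}"
  shows "circle_field F t"
proof -
  from assms(1) obtain p k where "field F" "finite (carrier F)" "odd p" "card (carrier F) = p ^ k"
    unfolding admissible_field_def by blast
  moreover have "odd (p ^ k)" using \<open>odd p\<close> by simp
  ultimately show ?thesis
    using assms(2) by (simp add: circle_field_def circle_field_axioms_def odd_finite_field_def odd_finite_field_axioms_def)
qed

text \<open>Already the radius t = 1 suffices, for which the circle contains (1, 0). A bound on q^e
  along arbitrarily large q forces e <= 0.\<close>

lemma uniformly_bounded_C4_op_necessary: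
  assumes p: "p1 \<in> {1..\<infinity>}" "p2 \<in> {1..\<infinity>}" "p3 \<in> {1..\<infinity>}" "p4 \<in> {1..\<infinity>}"
    and u: "u1 = 1 / real_of_ereal p1" "u2 = 1 / real_of_ereal p2" "u3 = 1 / real_of_ereal p3"
      "u4 = 1 / real_of_ereal p4"
    and "uniformly_bounded C4_op p1 p2 p3 p4"
  shows "2 * (u1 + u3) + (u2 + u4) \<le> 2" "(u1 + u3) + 2 * (u2 + u4) \<le> 2"
proof -
  obtain C where C: "1 \<le> C"
    "\<And>(F :: nat ring) t. admissible_field F \<Longrightarrow> t \<in> carrier F - {\<zero>\<^bsub>F\<^esub>} \<Longrightarrow> best_const C4_op F t p1 p2 p3 p4 \<le> C"
    using assms(9) unfolding uniformly_bounded_def by blast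
  have bound: "real (card (carrier F)) powr (2 * (u1 + u3) + (u2 + u4) - 2) \<le> 4 * C \<and>
      real (card (carrier F)) powr ((u1 + u3) + 2 * (u2 + u4) - 2) \<le> 4 * C"
    if F: "admissible_field F" for F :: "nat ring"
  proof -
    interpret field F using F by (simp add: admissible_field_def)
    have t: "\<one>\<^bsub>F\<^esub> \<in> carrier F - {\<zero>\<^bsub>F\<^esub>}" by simp
    have best: "best_const C4_op F \<one>\<^bsub>F\<^esub> p1 p2 p3 p4 \<le> C" using F t by (rule C)
    interpret circle_field F "\<one>\<^bsub>F\<^esub>" using F t by (rule admissible_field_imp_circle_field)
    have "(\<one>\<^bsub>F\<^esub>, \<zero>\<^bsub>F\<^esub>) \<in> circle F \<one>\<^bsub>F\<^esub>" by (simp add: circle_def plane_def sqnorm_def)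
    then have "circle F \<one>\<^bsub>F\<^esub> \<noteq> {}" by blast
    then show ?thesis using C4_op_necessary[OF p u _ best] C(1) by simp
  qed
  have "e \<le> 0" if e: "\<And>F :: nat ring. admissible_field F \<Longrightarrow> real (card (carrier F)) powr e \<le> 4 * C" for e
  proof (rule ccontr)
    assume "\<not> e \<le> 0"
    obtain F :: "nat ring" where F: "admissible_field F" "nat \<lceil>(4 * C) powr (1 / e)\<rceil> < card (carrier F)"
      using admissible_fields_unbounded by blast
    have "(4 * C) powr (1 / e) < real (card (carrier F))" using F(2) by linarith
    then have "((4 * C) powr (1 / e)) powr e < real (card (carrier F)) powr e"
      using \<open>\<not> e \<le> 0\<close> by (intro powr_less_mono2) auto
    then show False using e[OF F(1)] \<open>\<not> e \<le> 0\<close> C(1) by (simp add: powr_powr)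
  qed
  from this[of "2 * (u1 + u3) + (u2 + u4) - 2"] this[of "(u1 + u3) + 2 * (u2 + u4) - 2"]
  show "2 * (u1 + u3) + (u2 + u4) \<le> 2" "(u1 + u3) + 2 * (u2 + u4) \<le> 2" using bound by auto
qed

theorem theorem7p7:
  shows "(\<forall>p1\<in>{1..\<infinity>}. \<forall>p2\<in>{1..\<infinity>}. \<forall>p3\<in>{1..\<infinity>}. \<forall>p4\<in>{1..\<infinity>}.
            uniformly_bounded C4_op p1 p2 p3 p4 \<longrightarrow> uniformly_bounded C4_diag_op p1 p2 p3 p4) \<and>
         (\<exists>a\<in>{1..\<infinity>}. \<exists>b\<in>{1..\<infinity>}. \<exists>c\<in>{1..\<infinity>}. \<exists>e\<in>{1..\<infinity>}.
            uniformly_bounded C4_diag_op a b c e \<and> \<not> uniformly_bounded C4_op a b c e)"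
proof (intro conjI ballI impI)
  fix p1 p2 p3 p4 :: ereal
  assume p: "p1 \<in> {1..\<infinity>}" "p2 \<in> {1..\<infinity>}" "p3 \<in> {1..\<infinity>}" "p4 \<in> {1..\<infinity>}"
    and "uniformly_bounded C4_op p1 p2 p3 p4"
  note u = uniformly_bounded_C4_op_necessary[OF p refl refl refl refl this(5)]
  have "best_const C4_diag_op F t p1 p2 p3 p4 \<le> 3520"
    if "admissible_field F" "t \<in> carrier F - {\<zero>\<^bsub>F\<^esub>}" for F :: "nat ring" and t
    using circle_field.best_const_C4_diag_op_le[OF admissible_field_imp_circle_field[OF that] p refl refl refl refl u] .
  then show "uniformly_bounded C4_diag_op p1 p2 p3 p4"
    unfolding uniformly_bounded_def by (intro exI[of _ 3520]) auto
next
  have p: "ereal (3/2) \<in> {1..\<infinity>}" "(\<infinity>::ereal) \<in> {1..\<infinity>}"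
    by (simp_all add: one_ereal_def)
  have "best_const C4_diag_op F t (ereal (3/2)) \<infinity> (ereal (3/2)) \<infinity> \<le> 3520"
    if "admissible_field F" "t \<in> carrier F - {\<zero>\<^bsub>F\<^esub>}" for F :: "nat ring" and t
    using circle_field.best_const_C4_diag_op_diagonal_le[OF admissible_field_imp_circle_field[OF that]] .
  then have "uniformly_bounded C4_diag_op (ereal (3/2)) \<infinity> (ereal (3/2)) \<infinity>"
    unfolding uniformly_bounded_def by (intro exI[of _ 3520]) auto
  \<comment> \<open>The first necessary inequality would read 2 (2/3 + 2/3) + 0 = 8/3 <= 2.\<close>
  moreover have "\<not> uniformly_bounded C4_op (ereal (3/2)) \<infinity> (ereal (3/2)) \<infinity>"
    using uniformly_bounded_C4_op_necessary(1)[OF p p refl refl refl refl] by auto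
  ultimately show "\<exists>a\<in>{1..\<infinity>}. \<exists>b\<in>{1..\<infinity>}. \<exists>c\<in>{1..\<infinity>}. \<exists>e\<in>{1..\<infinity>}.
            uniformly_bounded C4_diag_op a b c e \<and> \<not> uniformly_bounded C4_op a b c e"
    using p by blast
qed

end
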